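(* Let $X=(X_1,\ldots,X_m)$ be a centered Gaussian vector with unit coordinate variances, correlation matrix $\Sigma=(\rho_{ij})$, and $|\rho_{ij}|<1$ for $i\ne j$, and let $\Gamma$ be its correlation graph. If $T(\Gamma)=C(\Gamma)$, then the labelled moments $$\{\mathbb{E}|X_iX_j|:1\le i<j\le m\}\quad\text{and}\quad\{\mathbb{E}|X_iX_jX_k|:1\le i<j<k\le m\}$$ determine $\Sigma$ up to diagonal sign conjugacy $\Sigma\mapsto D_\varepsilon\Sigma D_\varepsilon$, where $D_\varepsilon=\operatorname{diag}(\varepsilon_1,\ldots,\varepsilon_m)$ and $\varepsilon\in\{\pm1\}^m$. If $\Gamma$ is complete, it is enough to use the pair moments together with the anchored triple moments $$\{\mathbb{E}|X_1X_iX_j|:2\le i<j\le m\}.$$ Thus, for a complete correlation graph, the displayed reconstruction uses $$\binom m2+\binom{m-1}2=(m-1)^2$$ nontrivial labelled observations. No rank restriction on $\Sigma$ is required, and no absolute product moment of order four or higher is used. Equivalently, under the stated graph condition, the correlation matrix of the standard centered multivariate folded-normal vector $(|X_1|,\ldots,|X_m|)$ is identifiable from its labelled second- and third-order product moments up to diagonal sign conjugacy.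
   Context: The correlation graph $\Gamma$ of $\Sigma$ has vertex set $\{1,\ldots,m\}$ and an edge $ij$ ($i\ne j$) exactly when $\rho_{ij}\ne0$. $C(\Gamma)$ is its cycle space over $\mathbb{F}_2$, and $T(\Gamma)\subseteq C(\Gamma)$ is the subspace generated by the triangles of $\Gamma$. "Determine up to diagonal sign conjugacy" means: any other correlation matrix $\Sigma'$ whose centered Gaussian vector has the same listed labelled moments equals $D_\varepsilon\Sigma D_\varepsilon$ for some $\varepsilon\in\{\pm1\}^m$. $\Sigma$ may be singular. *)

theory Defs
  imports "HOL-Probability.Probability" "HOL-Library.Z2"
begin

text \<open>
  The index set \<open>{1,\<dots>,m}\<close> is a finite linearly ordered type \<open>'n\<close> with \<open>m = CARD('n)\<close>;
  the index \<open>1\<close> is \<open>Min UNIV\<close>.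
\<close>

section \<open>Gaussian vectors\<close>

text \<open>Point masses are Gaussian, so that singular correlation matrices are allowed.\<close>

definition gaussian_rv :: "'a measure \<Rightarrow> ('a \<Rightarrow> real) \<Rightarrow> bool" where
  "gaussian_rv M Y \<longleftrightarrow> Y \<in> borel_measurable M \<and>
     ((\<exists>\<mu>. AE \<omega> in M. Y \<omega> = \<mu>) \<or>
      (\<exists>\<mu> \<sigma>. 0 < \<sigma> \<and> distributed M lborel Y (\<lambda>x. ennreal (normal_density \<mu> \<sigma> x))))"

definition gaussian_vector :: "'a measure \<Rightarrow> ('a \<Rightarrow> real ^ 'n) \<Rightarrow> bool" where
  "gaussian_vector M X \<longleftrightarrow> prob_space M \<and> X \<in> borel_measurable M \<and>
     (\<forall>a. gaussian_rv M (\<lambda>\<omega>. a \<bullet> X \<omega>))"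

definition covariance :: "'a measure \<Rightarrow> ('a \<Rightarrow> real) \<Rightarrow> ('a \<Rightarrow> real) \<Rightarrow> real" where
  "covariance M U V =
     (\<integral>\<omega>. (U \<omega> - (\<integral>\<omega>. U \<omega> \<partial>M)) * (V \<omega> - (\<integral>\<omega>. V \<omega> \<partial>M)) \<partial>M)"

definition correlation_matrix :: "'a measure \<Rightarrow> ('a \<Rightarrow> real ^ 'n) \<Rightarrow> real ^ 'n ^ 'n" where
  "correlation_matrix M X = (\<chi> i j.
     covariance M (\<lambda>\<omega>. X \<omega> $ i) (\<lambda>\<omega>. X \<omega> $ j) /
       sqrt (prob_space.variance M (\<lambda>\<omega>. X \<omega> $ i) * prob_space.variance M (\<lambda>\<omega>. X \<omega> $ j)))"

definition standard_gaussian_vector ::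
    "'a measure \<Rightarrow> ('a \<Rightarrow> real ^ 'n) \<Rightarrow> real ^ 'n ^ 'n \<Rightarrow> bool" where
  "standard_gaussian_vector M X \<Sigma> \<longleftrightarrow> gaussian_vector M X \<and>
     (\<forall>i. (\<integral>\<omega>. X \<omega> $ i \<partial>M) = 0) \<and>
     (\<forall>i. prob_space.variance M (\<lambda>\<omega>. X \<omega> $ i) = 1) \<and>
     correlation_matrix M X = \<Sigma>"

definition folded :: "('a \<Rightarrow> real ^ 'n) \<Rightarrow> 'a \<Rightarrow> real ^ 'n" where
  "folded X = (\<lambda>\<omega>. \<chi> i. \<bar>X \<omega> $ i\<bar>)"

section \<open>Labelled moments\<close>

definition pair_labels :: "('n::linorder \<times> 'n) set" where
  "pair_labels = {(i, j). i < j}"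

definition triple_labels :: "('n::linorder \<times> 'n \<times> 'n) set" where
  "triple_labels = {(i, j, k). i < j \<and> j < k}"

definition anchored_triple_labels :: "('n::{finite,linorder} \<times> 'n \<times> 'n) set" where
  "anchored_triple_labels = {(i, j, k). i = Min UNIV \<and> i < j \<and> j < k}"

definition abs_pair_moment :: "'a measure \<Rightarrow> ('a \<Rightarrow> real ^ 'n) \<Rightarrow> 'n \<times> 'n \<Rightarrow> real" where
  "abs_pair_moment M X = (\<lambda>(i, j). \<integral>\<omega>. \<bar>X \<omega> $ i * X \<omega> $ j\<bar> \<partial>M)"

definition abs_triple_moment :: "'a measure \<Rightarrow> ('a \<Rightarrow> real ^ 'n) \<Rightarrow> 'n \<times> 'n \<times> 'n \<Rightarrow> real" where
  "abs_triple_moment M X = (\<lambda>(i, j, k). \<integral>\<omega>. \<bar>X \<omega> $ i * X \<omega> $ j * X \<omega> $ k\<bar> \<partial>M)"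

definition pair_moment :: "'a measure \<Rightarrow> ('a \<Rightarrow> real ^ 'n) \<Rightarrow> 'n \<times> 'n \<Rightarrow> real" where
  "pair_moment M Y = (\<lambda>(i, j). \<integral>\<omega>. Y \<omega> $ i * Y \<omega> $ j \<partial>M)"

definition triple_moment :: "'a measure \<Rightarrow> ('a \<Rightarrow> real ^ 'n) \<Rightarrow> 'n \<times> 'n \<times> 'n \<Rightarrow> real" where
  "triple_moment M Y = (\<lambda>(i, j, k). \<integral>\<omega>. Y \<omega> $ i * Y \<omega> $ j * Y \<omega> $ k \<partial>M)"

section \<open>Diagonal sign conjugacy\<close>

definition diag :: "real ^ 'n \<Rightarrow> real ^ 'n ^ 'n" where
  "diag \<epsilon> = (\<chi> i j. if i = j then \<epsilon> $ i else 0)"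

definition sign_conjugate :: "real ^ 'n ^ 'n \<Rightarrow> real ^ 'n ^ 'n \<Rightarrow> bool" where
  "sign_conjugate \<Sigma> \<Sigma>' \<longleftrightarrow>
     (\<exists>\<epsilon>. (\<forall>i. \<epsilon> $ i \<in> {1, -1}) \<and> \<Sigma>' = diag \<epsilon> ** \<Sigma> ** diag \<epsilon>)"

section \<open>The correlation graph and its cycle space\<close>

definition correlation_edges :: "real ^ 'n ^ 'n \<Rightarrow> 'n set set" where
  "correlation_edges \<Sigma> = {{i, j} | i j. i \<noteq> j \<and> \<Sigma> $ i $ j \<noteq> 0}"

definition is_complete :: "'n set set \<Rightarrow> bool" where
  "is_complete E \<longleftrightarrow> (\<forall>i j. i \<noteq> j \<longrightarrow> {i, j} \<in> E)"

text \<open>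
  Edge chains over the two-element field are vectors of type \<open>bit ^ ('n set)\<close> vanishing outside
  the edge set. The cycle space is the kernel of the boundary map, i.e. the set of chains that
  have even degree at every vertex.
\<close>

definition cycle_space :: "'n::finite set set \<Rightarrow> (bit ^ ('n set)) set" where
  "cycle_space E = {f. (\<forall>e. e \<notin> E \<longrightarrow> f $ e = 0) \<and> (\<forall>v. (\<Sum>e\<in>{e \<in> E. v \<in> e}. f $ e) = 0)}"

definition triangle_chain :: "'n::finite \<Rightarrow> 'n \<Rightarrow> 'n \<Rightarrow> bit ^ ('n set)" where
  "triangle_chain i j k = (\<chi> e. if e \<in> {{i, j}, {j, k}, {i, k}} then 1 else 0)"

definition triangle_space :: "'n::finite set set \<Rightarrow> (bit ^ ('n set)) set" where
  "triangle_space E = vec.span {triangle_chain i j k | i j k.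
     i \<noteq> j \<and> j \<noteq> k \<and> i \<noteq> k \<and> {i, j} \<in> E \<and> {j, k} \<in> E \<and> {i, k} \<in> E}"

end

theory Submission
  imports Defs
begin

text \<open>
  Up to a positive constant, \<open>\<bar>x\<bar>\<close> is the integral of \<open>(1 - cos (u x)) / u\<^sup>2\<close> over \<open>u\<close>. By Tonelli an
  absolute product moment is therefore an integral of expectations of products \<open>1 - cos (u X\<^sub>i)\<close>, and
  these are explicit in the correlations through the characteristic function, also for singular
  \<open>\<Sigma>\<close>. For pairs the correlation enters only through \<open>cosh (\<rho> u v)\<close>, so the moment
  is strictly increasing in \<open>\<bar>\<rho>\<bar>\<close>. For triples the only term that sees the signs of the
  correlations \<open>a, b, c\<close> is \<open>sinh (a u v) sinh (b u w) sinh (c v w)\<close>, which has the sign of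
  \<open>a b c\<close> for all nonzero \<open>u, v, w\<close>; hence the moment determines the sign of \<open>a b c\<close>.

  The edges on which the signs of \<open>\<Sigma>\<close> and \<open>\<Sigma>'\<close> differ thus form a cochain over the two-element
  field that vanishes on triangles. If triangles generate the cycle space, it vanishes on all cycles
  and is a coboundary, and a vertex function with this coboundary is the required sign vector.
\<close>

section \<open>Absolute values as cosine integrals\<close>

definition abs_kernel :: "real \<Rightarrow> real \<Rightarrow> real" where
  "abs_kernel u x = (1 - cos (u * x)) / u\<^sup>2"

text \<open>This number is \<pi>. The comparisons below cancel it as a finite factor, so it is never
  evaluated.\<close>

definition abs_const :: ennreal where
  "abs_const = (\<integral>\<^sup>+u. ennreal (abs_kernel u 1) \<partial>lborel)"

lemma abs_kernel_nonneg [simp]: "0 \<le> abs_kernel u x"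
  by (simp add: abs_kernel_def)

lemma abs_kernel_measurable [measurable (raw)]:
  assumes [measurable]: "f \<in> borel_measurable N" "g \<in> borel_measurable N"
  shows "(\<lambda>p. abs_kernel (f p) (g p)) \<in> borel_measurable N"
  unfolding abs_kernel_def by measurable

lemma one_minus_cos_le: "1 - cos (u::real) \<le> u\<^sup>2 / 2"
proof -
  have "1 - cos u = 2 * (sin (u/2))\<^sup>2"
    using cos_double_sin[of "u/2"] by simp
  also have "(sin (u/2))\<^sup>2 \<le> (u/2)\<^sup>2"
    using abs_sin_x_le_abs_x[of "u/2"] by (metis abs_le_square_iff)
  finally show ?thesis by (simp add: power2_eq_square)
qed

text \<open>An integrable majorant. Near 0 the bound \<open>u^2 / 2\<close> on
  \<open>1 - cos u\<close> is the good one, far out the bound 2; multiplied by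
  \<open>1 + u^2\<close>, they contribute 1/2 and 2 to the constant 5/2.\<close>

lemma abs_kernel_one_le: "abs_kernel u 1 \<le> (5/2) * (1 / (1 + u\<^sup>2))"
proof (cases "u = 0")
  case False
  have "(1 - cos u) * (1 + u\<^sup>2) \<le> u\<^sup>2 / 2 + 2 * u\<^sup>2"
  proof -
    have "(1 - cos u) * u\<^sup>2 \<le> 2 * u\<^sup>2"
      by (intro mult_right_mono) (use cos_ge_minus_one[of u] in linarith, simp)
    then show ?thesis using one_minus_cos_le[of u] by (simp add: algebra_simps)
  qed
  moreover have "0 < 1 + u\<^sup>2" by (simp add: add_pos_nonneg)
  ultimately show ?thesis using False
    by (simp add: abs_kernel_def divide_simps) (simp add: algebra_simps)
qed (simp add: abs_kernel_def)

lemma abs_const_finite: "abs_const < \<infinity>"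
proof -
  let ?f = "\<lambda>u::real. 1 / (1 + u\<^sup>2)"
  let ?h = "\<lambda>u::real. ennreal (?f u) * indicator {0..} u"
  have h: "(\<integral>\<^sup>+u. ?h u \<partial>lborel) = ennreal (pi / 2 - arctan 0)"
  proof (rule nn_integral_FTC_atLeast)
    show "DERIV arctan x :> ?f x" for x
      using DERIV_arctan[of x] by (simp add: inverse_eq_divide)
  qed (auto intro: tendsto_arctan_at_top)
  \<comment> \<open>The majorant on the whole line is covered by its two half-line copies, which
    overlap only at 0. The form \<open>0 + (-1) * u\<close> is the affine substitution applied
    below.\<close>
  have "abs_const \<le> (\<integral>\<^sup>+u. ennreal (5/2) * (?h u + ?h (0 + (-1) * u)) \<partial>lborel)"
    unfolding abs_const_def
  proof (rule nn_integral_mono)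
    fix u :: real
    have "ennreal (abs_kernel u 1) \<le> ennreal (5/2) * ennreal (?f u)"
      using abs_kernel_one_le[of u] by (simp flip: ennreal_mult)
    also have "\<dots> \<le> ennreal (5/2) * (?h u + ?h (0 + (-1) * u))"
      by (intro mult_left_mono) (auto split: split_indicator)
    finally show "ennreal (abs_kernel u 1) \<le> ennreal (5/2) * (?h u + ?h (0 + (-1) * u))" .
  qed
  also have "\<dots> = ennreal (5/2) * ((\<integral>\<^sup>+u. ?h u \<partial>lborel) + (\<integral>\<^sup>+u. ?h (0 + (-1) * u) \<partial>lborel))"
    by (simp add: nn_integral_cmult nn_integral_add)
  also have "(\<integral>\<^sup>+u. ?h (0 + (-1) * u) \<partial>lborel) = (\<integral>\<^sup>+u. ?h u \<partial>lborel)"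
    using nn_integral_real_affine[of ?h "-1" 0] by simp
  also have "ennreal (5/2) * ((\<integral>\<^sup>+u. ?h u \<partial>lborel) + (\<integral>\<^sup>+u. ?h u \<partial>lborel)) < \<infinity>"
    unfolding h by (simp flip: ennreal_mult ennreal_plus)
  finally show ?thesis .
qed

text \<open>Scaling: replacing \<open>u\<close> by \<open>u / x\<close> turns the kernel into
  \<open>x^2 * abs_kernel u 1\<close> and contributes the Jacobian
  \<open>1 / \<bar>x\<bar>\<close>.\<close>

lemma nn_integral_abs_kernel:
  "(\<integral>\<^sup>+u. ennreal (abs_kernel u x) \<partial>lborel) = ennreal \<bar>x\<bar> * abs_const"
proof (cases "x = 0")
  case True
  then show ?thesis by (simp add: abs_kernel_def)
next
  case False
  have "(\<integral>\<^sup>+u. ennreal (abs_kernel u x) \<partial>lborel)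
      = ennreal \<bar>1/x\<bar> * (\<integral>\<^sup>+u. ennreal (abs_kernel (0 + (1/x) * u) x) \<partial>lborel)"
    using False by (intro nn_integral_real_affine) auto
  also have "(\<integral>\<^sup>+u. ennreal (abs_kernel (0 + (1/x) * u) x) \<partial>lborel)
      = (\<integral>\<^sup>+u. ennreal (x\<^sup>2) * ennreal (abs_kernel u 1) \<partial>lborel)"
    using False
    by (intro nn_integral_cong) (simp add: abs_kernel_def power_divide flip: ennreal_mult)
  also have "\<dots> = ennreal (x\<^sup>2) * abs_const"
    by (simp add: abs_const_def nn_integral_cmult)
  also have "ennreal \<bar>1/x\<bar> * (ennreal (x\<^sup>2) * abs_const) = ennreal (\<bar>1/x\<bar> * x\<^sup>2) * abs_const"
    by (simp only: ennreal_mult[OF abs_ge_zero zero_le_power2] mult.assoc)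
  also have "\<bar>1/x\<bar> * x\<^sup>2 = \<bar>x\<bar>"
    using False by (simp add: power2_eq_square abs_if field_simps)
  finally show ?thesis .
qed

text \<open>Tonelli for a single factor. The weight \<open>g\<close> carries the other factors of a
  product, so that absolute values can be replaced by kernels one at a time, without any
  integrability condition.\<close>

lemma nn_integral_mult_abs:
  fixes x :: "'a \<Rightarrow> real"
  assumes "sigma_finite_measure M"
    and [measurable]: "g \<in> borel_measurable M" "x \<in> borel_measurable M"
  shows "(\<integral>\<^sup>+\<omega>. g \<omega> * ennreal \<bar>x \<omega>\<bar> \<partial>M) * abs_const
    = (\<integral>\<^sup>+u. (\<integral>\<^sup>+\<omega>. g \<omega> * ennreal (abs_kernel u (x \<omega>)) \<partial>M) \<partial>lborel)"
proof -
  interpret M: sigma_finite_measure M by fact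
  interpret P: pair_sigma_finite M lborel ..
  have "(\<integral>\<^sup>+\<omega>. g \<omega> * ennreal \<bar>x \<omega>\<bar> \<partial>M) * abs_const
      = (\<integral>\<^sup>+\<omega>. g \<omega> * (\<integral>\<^sup>+u. ennreal (abs_kernel u (x \<omega>)) \<partial>lborel) \<partial>M)"
    by (simp add: nn_integral_abs_kernel flip: nn_integral_multc mult.assoc)
  also have "\<dots> = (\<integral>\<^sup>+\<omega>. (\<integral>\<^sup>+u. g \<omega> * ennreal (abs_kernel u (x \<omega>)) \<partial>lborel) \<partial>M)"
    by (intro nn_integral_cong) (simp add: nn_integral_cmult)
  also have "\<dots> = (\<integral>\<^sup>+u. (\<integral>\<^sup>+\<omega>. g \<omega> * ennreal (abs_kernel u (x \<omega>)) \<partial>M) \<partial>lborel)"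
    by (intro P.Fubini'[symmetric]) measurable
  finally show ?thesis .
qed

lemma integrable_prod_one_minus_cos:
  fixes x y z :: "'a \<Rightarrow> real"
  assumes "prob_space M"
    and [measurable]: "x \<in> borel_measurable M" "y \<in> borel_measurable M" "z \<in> borel_measurable M"
  shows "integrable M (\<lambda>\<omega>. (1 - cos (x \<omega>)) * (1 - cos (y \<omega>)) * (1 - cos (z \<omega>)))"
proof -
  interpret prob_space M by fact
  have b: "\<bar>1 - cos t\<bar> \<le> 2" for t :: real
    using cos_ge_minus_one[of t] cos_le_one[of t] by linarith
  have "\<bar>(1 - cos r) * (1 - cos s) * (1 - cos t)\<bar> \<le> 2 * 2 * 2" for r s t :: real
    unfolding abs_mult by (intro mult_mono b) auto
  then show ?thesis
    by (intro integrable_const_bound[where B = 8]) auto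
qed

text \<open>Tonelli is applied once for each of the three factors. The innermost expectation has a
  bounded integrand, so it can be read as a Bochner integral, to which the characteristic function
  applies.\<close>

lemma abs_triple_moment_eq_integral:
  fixes x y z :: "'a \<Rightarrow> real"
  assumes M: "prob_space M"
    and [measurable]: "x \<in> borel_measurable M" "y \<in> borel_measurable M" "z \<in> borel_measurable M"
  shows "(\<integral>\<^sup>+\<omega>. ennreal \<bar>x \<omega> * y \<omega> * z \<omega>\<bar> \<partial>M) * abs_const ^ 3
    = (\<integral>\<^sup>+w. \<integral>\<^sup>+v. \<integral>\<^sup>+u. ennreal ((\<integral>\<omega>. (1 - cos (u * x \<omega>)) * (1 - cos (v * y \<omega>)) *
          (1 - cos (w * z \<omega>)) \<partial>M) / (u\<^sup>2 * v\<^sup>2 * w\<^sup>2)) \<partial>lborel \<partial>lborel \<partial>lborel)"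
proof -
  interpret prob_space M by fact
  have s: "sigma_finite_measure M" by unfold_locales
  let ?k = "\<lambda>u x \<omega>. ennreal (abs_kernel u (x \<omega>))"
  have "(\<integral>\<^sup>+\<omega>. ennreal \<bar>x \<omega> * y \<omega> * z \<omega>\<bar> \<partial>M) * abs_const ^ 3
    = (\<integral>\<^sup>+\<omega>. (ennreal \<bar>x \<omega>\<bar> * ennreal \<bar>y \<omega>\<bar>) * ennreal \<bar>z \<omega>\<bar> \<partial>M) * abs_const * (abs_const * abs_const)"
    by (simp add: abs_mult ennreal_mult power3_eq_cube mult.assoc)
  also have "\<dots> = (\<integral>\<^sup>+w. (\<integral>\<^sup>+\<omega>. (ennreal \<bar>x \<omega>\<bar> * ?k w z \<omega>) * ennreal \<bar>y \<omega>\<bar> \<partial>M) * abs_const * abs_const \<partial>lborel)"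
    by (subst nn_integral_mult_abs[OF s]; simp add: nn_integral_multc mult_ac nn_integral_cmult)
  also have "\<dots> = (\<integral>\<^sup>+w. \<integral>\<^sup>+v. (\<integral>\<^sup>+\<omega>. (?k w z \<omega> * ?k v y \<omega>) * ennreal \<bar>x \<omega>\<bar> \<partial>M) * abs_const \<partial>lborel \<partial>lborel)"
    by (subst nn_integral_mult_abs[OF s]; simp add: nn_integral_multc mult_ac nn_integral_cmult)
  also have "\<dots> = (\<integral>\<^sup>+w. \<integral>\<^sup>+v. \<integral>\<^sup>+u. (\<integral>\<^sup>+\<omega>. ?k w z \<omega> * ?k v y \<omega> * ?k u x \<omega> \<partial>M) \<partial>lborel \<partial>lborel \<partial>lborel)"
    by (subst nn_integral_mult_abs[OF s]) auto
  also have "\<dots> = (\<integral>\<^sup>+w. \<integral>\<^sup>+v. \<integral>\<^sup>+u. ennreal ((\<integral>\<omega>. (1 - cos (u * x \<omega>)) * (1 - cos (v * y \<omega>)) *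
          (1 - cos (w * z \<omega>)) \<partial>M) / (u\<^sup>2 * v\<^sup>2 * w\<^sup>2)) \<partial>lborel \<partial>lborel \<partial>lborel)"
  proof (intro nn_integral_cong)
    fix u v w :: real
    let ?g = "\<lambda>\<omega>. (1 - cos (u * x \<omega>)) * (1 - cos (v * y \<omega>)) * (1 - cos (w * z \<omega>))"
    have "(\<integral>\<^sup>+\<omega>. ?k w z \<omega> * ?k v y \<omega> * ?k u x \<omega> \<partial>M)
        = (\<integral>\<^sup>+\<omega>. ennreal (?g \<omega> / (u\<^sup>2 * v\<^sup>2 * w\<^sup>2)) \<partial>M)"
      by (intro nn_integral_cong) (simp add: abs_kernel_def mult_ac flip: ennreal_mult)
    also have "\<dots> = ennreal (\<integral>\<omega>. ?g \<omega> / (u\<^sup>2 * v\<^sup>2 * w\<^sup>2) \<partial>M)"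
      by (intro nn_integral_eq_integral integrable_divide_zero integrable_prod_one_minus_cos M)
         auto
    finally show "(\<integral>\<^sup>+\<omega>. ?k w z \<omega> * ?k v y \<omega> * ?k u x \<omega> \<partial>M)
        = ennreal ((\<integral>\<omega>. ?g \<omega> \<partial>M) / (u\<^sup>2 * v\<^sup>2 * w\<^sup>2))" by simp
  qed
  finally show ?thesis .
qed

lemma abs_pair_moment_eq_integral:
  fixes x y :: "'a \<Rightarrow> real"
  assumes M: "prob_space M"
    and [measurable]: "x \<in> borel_measurable M" "y \<in> borel_measurable M"
  shows "(\<integral>\<^sup>+\<omega>. ennreal \<bar>x \<omega> * y \<omega>\<bar> \<partial>M) * abs_const ^ 2
    = (\<integral>\<^sup>+v. \<integral>\<^sup>+u. ennreal ((\<integral>\<omega>. (1 - cos (u * x \<omega>)) * (1 - cos (v * y \<omega>)) \<partial>M) /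
         (u\<^sup>2 * v\<^sup>2)) \<partial>lborel \<partial>lborel)"
proof -
  interpret prob_space M by fact
  have s: "sigma_finite_measure M" by unfold_locales
  let ?k = "\<lambda>u x \<omega>. ennreal (abs_kernel u (x \<omega>))"
  have "(\<integral>\<^sup>+\<omega>. ennreal \<bar>x \<omega> * y \<omega>\<bar> \<partial>M) * abs_const ^ 2
    = (\<integral>\<^sup>+\<omega>. ennreal \<bar>x \<omega>\<bar> * ennreal \<bar>y \<omega>\<bar> \<partial>M) * abs_const * abs_const"
    by (simp add: abs_mult ennreal_mult power2_eq_square mult.assoc)
  also have "\<dots> = (\<integral>\<^sup>+v. (\<integral>\<^sup>+\<omega>. ?k v y \<omega> * ennreal \<bar>x \<omega>\<bar> \<partial>M) * abs_const \<partial>lborel)"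
    by (subst nn_integral_mult_abs[OF s]; simp add: nn_integral_multc mult_ac nn_integral_cmult)
  also have "\<dots> = (\<integral>\<^sup>+v. \<integral>\<^sup>+u. (\<integral>\<^sup>+\<omega>. ?k v y \<omega> * ?k u x \<omega> \<partial>M) \<partial>lborel \<partial>lborel)"
    by (subst nn_integral_mult_abs[OF s]) auto
  also have "\<dots> = (\<integral>\<^sup>+v. \<integral>\<^sup>+u. ennreal ((\<integral>\<omega>. (1 - cos (u * x \<omega>)) * (1 - cos (v * y \<omega>)) \<partial>M) /
         (u\<^sup>2 * v\<^sup>2)) \<partial>lborel \<partial>lborel)"
  proof (intro nn_integral_cong)
    fix u v :: real
    let ?g = "\<lambda>\<omega>. (1 - cos (u * x \<omega>)) * (1 - cos (v * y \<omega>))"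
    have "integrable M ?g"
      \<comment> \<open>With the constant \<open>pi\<close> in the third place, the third factor is
        \<open>1 - cos pi = 2\<close>, and the pair case follows from the triple case.\<close>
      using integrable_prod_one_minus_cos[OF M, of "\<lambda>\<omega>. u * x \<omega>" "\<lambda>\<omega>. v * y \<omega>" "\<lambda>_. pi"] by simp
    moreover have "(\<integral>\<^sup>+\<omega>. ?k v y \<omega> * ?k u x \<omega> \<partial>M) = (\<integral>\<^sup>+\<omega>. ennreal (?g \<omega> / (u\<^sup>2 * v\<^sup>2)) \<partial>M)"
      by (intro nn_integral_cong) (simp add: abs_kernel_def mult_ac flip: ennreal_mult)
    moreover have "\<dots> = ennreal (\<integral>\<omega>. ?g \<omega> / (u\<^sup>2 * v\<^sup>2) \<partial>M)"
      using calculation(1) by (intro nn_integral_eq_integral integrable_divide_zero) auto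
    ultimately show "(\<integral>\<^sup>+\<omega>. ?k v y \<omega> * ?k u x \<omega> \<partial>M)
        = ennreal ((\<integral>\<omega>. ?g \<omega> \<partial>M) / (u\<^sup>2 * v\<^sup>2))" by simp
  qed
  finally show ?thesis .
qed

section \<open>Comparison of absolute moments\<close>

lemma abs_le_abs_sinh: "\<bar>t\<bar> \<le> \<bar>sinh t\<bar>" for t :: real
  using real_le_abs_sinh[of t] by (simp add: sinh_field_def exp_minus)

text \<open>With \<open>p\<close> and \<open>q\<close> the half sum and half difference of the
  absolute values, the difference is \<open>2 * sinh p * sinh q\<close>, and \<open>sinh\<close>
  dominates the identity on nonnegative arguments. The quadratic lower bound is what later cancels
  the denominators \<open>u^2 * v^2\<close>.\<close>

lemma cosh_diff_ge:
  fixes s t :: real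
  assumes "\<bar>t\<bar> \<le> \<bar>s\<bar>"
  shows "(s\<^sup>2 - t\<^sup>2) / 2 \<le> cosh s - cosh t"
proof -
  define p q where "p = (\<bar>s\<bar> + \<bar>t\<bar>) / 2" and "q = (\<bar>s\<bar> - \<bar>t\<bar>) / 2"
  have st: "\<bar>s\<bar> = p + q" "\<bar>t\<bar> = p - q" and pq: "0 \<le> p" "0 \<le> q"
    using assms by (auto simp: p_def q_def field_simps)
  have "cosh s - cosh t = cosh \<bar>s\<bar> - cosh \<bar>t\<bar>" by simp
  also have "\<dots> = 2 * (sinh p * sinh q)"
    unfolding st by (simp add: cosh_add cosh_diff)
  also have "\<dots> \<ge> 2 * (p * q)"
    using pq abs_le_abs_sinh[of p] abs_le_abs_sinh[of q] by (intro mult_left_mono mult_mono) auto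
  also have "2 * (p * q) = (\<bar>s\<bar>\<^sup>2 - \<bar>t\<bar>\<^sup>2) / 2"
    unfolding st by (simp add: power2_eq_square field_simps)
  finally show ?thesis by simp
qed

text \<open>The weight vanishes at \<open>0\<close> because \<open>abs_kernel 0 x = 0\<close>, as \<open>x / 0 = 0\<close>.\<close>

definition gauss_weight :: "real \<Rightarrow> real" where
  "gauss_weight u = (if u = 0 then 0 else exp (- u\<^sup>2 / 2))"

lemma gauss_weight_measurable [measurable]: "gauss_weight \<in> borel_measurable borel"
  unfolding gauss_weight_def by measurable

lemma gauss_weight_nonneg [simp]: "0 \<le> gauss_weight u"
  by (simp add: gauss_weight_def)

text \<open>The weight is positive off the null set {0}. This turns a pointwise gap between
  integrands into a strict inequality of moments.\<close>

lemma gauss_weight_integral_pos: "(\<integral>\<^sup>+u. ennreal (gauss_weight u) \<partial>lborel) \<noteq> 0"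
proof
  assume "(\<integral>\<^sup>+u. ennreal (gauss_weight u) \<partial>lborel) = 0"
  then have "AE u in lborel. gauss_weight u = 0"
    by (simp add: nn_integral_0_iff_AE ennreal_eq_0_iff)
      (auto elim!: AE_mp simp: antisym)
  moreover have "AE u in lborel. u \<noteq> (0::real)" by (rule AE_lborel_singleton)
  ultimately have "AE u in (lborel :: real measure). False"
    by eventually_elim (simp add: gauss_weight_def)
  from AE_E2[OF this] show False by simp
qed

section \<open>Expectations of cosine products in terms of the correlations\<close>

lemma prod_one_minus_cos_2:
  "(1 - cos p) * (1 - cos q) = 1 - cos p - cos q + (cos (p + q) + cos (p - q)) / 2" for p q :: real
  by (simp add: cos_add cos_diff algebra_simps)

lemma prod_one_minus_cos_3:
  "(1 - cos p) * (1 - cos q) * (1 - cos r) = 1 - cos p - cos q - cos r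
    + (cos (p + q) + cos (p - q)) / 2 + (cos (p + r) + cos (p - r)) / 2
    + (cos (q + r) + cos (q - r)) / 2
    - (cos (p + q + r) + cos (p + q - r) + cos (p - q + r) + cos (p - q - r)) / 4" for p q r :: real
  by (simp add: cos_add cos_diff sin_add sin_diff field_simps)

text \<open>The product-to-sum formula averages the characteristic function over the two signs of
  \<open>v\<close>, which turns the mixed exponential into a \<open>cosh\<close>.\<close>

lemma expectation_one_minus_cos_2:
  fixes x y :: "'a \<Rightarrow> real"
  assumes M: "prob_space M"
    and [measurable]: "x \<in> borel_measurable M" "y \<in> borel_measurable M"
    and char: "\<And>u v. (\<integral>\<omega>. cos (u * x \<omega> + v * y \<omega>) \<partial>M) = exp (- (u\<^sup>2 + v\<^sup>2 + 2 * (a * u * v)) / 2)"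
  shows "(\<integral>\<omega>. (1 - cos (u * x \<omega>)) * (1 - cos (v * y \<omega>)) \<partial>M)
    = 1 - exp (- u\<^sup>2 / 2) - exp (- v\<^sup>2 / 2) + exp (- u\<^sup>2 / 2) * exp (- v\<^sup>2 / 2) * cosh (a * u * v)"
proof -
  interpret prob_space M by fact
  have i: "integrable M (\<lambda>\<omega>. cos (f \<omega>))" if "f \<in> borel_measurable M" for f :: "'a \<Rightarrow> real"
    using that by (intro integrable_const_bound[where B = 1]) auto
  have "(\<integral>\<omega>. (1 - cos (u * x \<omega>)) * (1 - cos (v * y \<omega>)) \<partial>M)
    = 1 - (\<integral>\<omega>. cos (u * x \<omega>) \<partial>M) - (\<integral>\<omega>. cos (v * y \<omega>) \<partial>M)
      + ((\<integral>\<omega>. cos (u * x \<omega> + v * y \<omega>) \<partial>M) + (\<integral>\<omega>. cos (u * x \<omega> - v * y \<omega>) \<partial>M)) / 2"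
    by (simp add: prod_one_minus_cos_2 i prob_space)
  then show ?thesis
    using char[of u 0] char[of 0 v] char[of u v] char[of u "-v"]
    by (simp add: cosh_field_def field_simps flip: exp_add)
qed

text \<open>Terms in at most two variables average to \<open>cosh\<close> as for pairs. The term in
  all three averages over the signs of \<open>v\<close> and \<open>w\<close>, and this leaves a
  product of \<open>sinh\<close> besides the product of \<open>cosh\<close>.\<close>

lemma expectation_one_minus_cos_3:
  fixes x y z :: "'a \<Rightarrow> real"
  assumes M: "prob_space M"
    and [measurable]: "x \<in> borel_measurable M" "y \<in> borel_measurable M" "z \<in> borel_measurable M"
    and char: "\<And>u v w. (\<integral>\<omega>. cos (u * x \<omega> + v * y \<omega> + w * z \<omega>) \<partial>M)
      = exp (- (u\<^sup>2 + v\<^sup>2 + w\<^sup>2 + 2 * (a * u * v) + 2 * (b * u * w) + 2 * (c * v * w)) / 2)"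
  shows "(\<integral>\<omega>. (1 - cos (u * x \<omega>)) * (1 - cos (v * y \<omega>)) * (1 - cos (w * z \<omega>)) \<partial>M)
    = 1 - exp (- u\<^sup>2 / 2) - exp (- v\<^sup>2 / 2) - exp (- w\<^sup>2 / 2)
      + exp (- u\<^sup>2 / 2) * exp (- v\<^sup>2 / 2) * cosh (a * u * v)
      + exp (- u\<^sup>2 / 2) * exp (- w\<^sup>2 / 2) * cosh (b * u * w)
      + exp (- v\<^sup>2 / 2) * exp (- w\<^sup>2 / 2) * cosh (c * v * w)
      - exp (- u\<^sup>2 / 2) * exp (- v\<^sup>2 / 2) * exp (- w\<^sup>2 / 2)
        * (cosh (a * u * v) * cosh (b * u * w) * cosh (c * v * w)
           - sinh (a * u * v) * sinh (b * u * w) * sinh (c * v * w))"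
proof -
  interpret prob_space M by fact
  have i: "integrable M (\<lambda>\<omega>. cos (f \<omega>))" if "f \<in> borel_measurable M" for f :: "'a \<Rightarrow> real"
    using that by (intro integrable_const_bound[where B = 1]) auto
  let ?C = "\<lambda>u v w. \<integral>\<omega>. cos (u * x \<omega> + v * y \<omega> + w * z \<omega>) \<partial>M"
  have E: "(\<integral>\<omega>. (1 - cos (u * x \<omega>)) * (1 - cos (v * y \<omega>)) * (1 - cos (w * z \<omega>)) \<partial>M)
    = 1 - ?C u 0 0 - ?C 0 v 0 - ?C 0 0 w + (?C u v 0 + ?C u (-v) 0) / 2
      + (?C u 0 w + ?C u 0 (-w)) / 2 + (?C 0 v w + ?C 0 v (-w)) / 2
      - (?C u v w + ?C u v (-w) + ?C u (-v) w + ?C u (-v) (-w)) / 4"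
    by (simp add: prod_one_minus_cos_3 i prob_space)
  have pair: "exp (- (r\<^sup>2 + s\<^sup>2 + 2 * t) / 2) + exp (- (r\<^sup>2 + s\<^sup>2 - 2 * t) / 2)
      = 2 * (exp (- r\<^sup>2 / 2) * exp (- s\<^sup>2 / 2) * cosh t)" for r s t :: real
    by (simp add: cosh_field_def field_simps flip: exp_add)
  \<comment> \<open>Flipping the sign of one variable flips two of the three mixed terms. Hence only
    sign patterns with product -1 occur in the exponents, and their average is
    \<open>cosh cosh cosh\<close> minus \<open>sinh sinh sinh\<close>.\<close>
  have hyp: "cosh p * cosh q * cosh r - sinh p * sinh q * sinh r
      = (exp (- p - q - r) + exp (- p + q + r) + exp (p - q + r) + exp (p + q - r)) / 4"
    for p q r :: real
    by (simp add: cosh_field_def sinh_field_def field_simps flip: exp_add)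
  have split: "exp (- (u\<^sup>2 + v\<^sup>2 + w\<^sup>2 + 2 * p + 2 * q + 2 * r) / 2)
      = exp (- u\<^sup>2 / 2) * exp (- v\<^sup>2 / 2) * exp (- w\<^sup>2 / 2) * exp (- p - q - r)" for p q r :: real
    by (simp add: field_simps flip: exp_add)
  have triple: "exp (- (u\<^sup>2 + v\<^sup>2 + w\<^sup>2 + 2 * p + 2 * q + 2 * r) / 2)
      + exp (- (u\<^sup>2 + v\<^sup>2 + w\<^sup>2 + 2 * p - 2 * q - 2 * r) / 2)
      + exp (- (u\<^sup>2 + v\<^sup>2 + w\<^sup>2 - 2 * p + 2 * q - 2 * r) / 2)
      + exp (- (u\<^sup>2 + v\<^sup>2 + w\<^sup>2 - 2 * p - 2 * q + 2 * r) / 2)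
      = 4 * (exp (- u\<^sup>2 / 2) * exp (- v\<^sup>2 / 2) * exp (- w\<^sup>2 / 2)
        * (cosh p * cosh q * cosh r - sinh p * sinh q * sinh r))" for p q r :: real
    unfolding hyp
    using split[of p q r] split[of p "-q" "-r"] split[of "-p" q "-r"] split[of "-p" "-q" r]
    by (simp add: algebra_simps)
  have "?C u v 0 + ?C u (-v) 0 = 2 * (exp (- u\<^sup>2 / 2) * exp (- v\<^sup>2 / 2) * cosh (a * u * v))"
    "?C u 0 w + ?C u 0 (-w) = 2 * (exp (- u\<^sup>2 / 2) * exp (- w\<^sup>2 / 2) * cosh (b * u * w))"
    "?C 0 v w + ?C 0 v (-w) = 2 * (exp (- v\<^sup>2 / 2) * exp (- w\<^sup>2 / 2) * cosh (c * v * w))"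
    unfolding char
    using pair[of u v "a * u * v"] pair[of u w "b * u * w"] pair[of v w "c * v * w"] by simp_all
  moreover have "?C u v w + ?C u v (-w) + ?C u (-v) w + ?C u (-v) (-w)
      = 4 * (exp (- u\<^sup>2 / 2) * exp (- v\<^sup>2 / 2) * exp (- w\<^sup>2 / 2)
        * (cosh (a * u * v) * cosh (b * u * w) * cosh (c * v * w)
           - sinh (a * u * v) * sinh (b * u * w) * sinh (c * v * w)))"
    unfolding char triple[symmetric] by simp
  moreover have "?C u 0 0 = exp (- u\<^sup>2 / 2)" "?C 0 v 0 = exp (- v\<^sup>2 / 2)" "?C 0 0 w = exp (- w\<^sup>2 / 2)"
    unfolding char by simp_all
  ultimately show ?thesis
    unfolding E by simp
qed

section \<open>Pair moments and absolute correlations\<close>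

text \<open>The integrands in the cosine representation differ by at least
  \<open>d * g u * g v\<close> with \<open>d > 0\<close>, and this product has nonzero double
  integral.\<close>

lemma abs_pair_moment_strict_mono:
  fixes x y :: "'a \<Rightarrow> real" and x' y' :: "'b \<Rightarrow> real"
  assumes M: "prob_space M"
    and m: "x \<in> borel_measurable M" "y \<in> borel_measurable M"
    and char: "\<And>u v. (\<integral>\<omega>. cos (u * x \<omega> + v * y \<omega>) \<partial>M) = exp (- (u\<^sup>2 + v\<^sup>2 + 2 * (a * u * v)) / 2)"
    and M': "prob_space M'"
    and m': "x' \<in> borel_measurable M'" "y' \<in> borel_measurable M'"
    and char': "\<And>u v. (\<integral>\<omega>. cos (u * x' \<omega> + v * y' \<omega>) \<partial>M') = exp (- (u\<^sup>2 + v\<^sup>2 + 2 * (a' * u * v)) / 2)"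
    and int: "integrable M (\<lambda>\<omega>. \<bar>x \<omega> * y \<omega>\<bar>)" "integrable M' (\<lambda>\<omega>. \<bar>x' \<omega> * y' \<omega>\<bar>)"
    and less: "\<bar>a'\<bar> < \<bar>a\<bar>"
  shows "(\<integral>\<omega>. \<bar>x' \<omega> * y' \<omega>\<bar> \<partial>M') < (\<integral>\<omega>. \<bar>x \<omega> * y \<omega>\<bar> \<partial>M)"
proof (rule ccontr)
  define g where "g = gauss_weight"
  have g[measurable]: "g \<in> borel_measurable borel" "\<And>u. 0 \<le> g u"
    and g0: "(\<integral>\<^sup>+u. ennreal (g u) \<partial>lborel) \<noteq> 0"
    by (auto simp: g_def gauss_weight_integral_pos)
  define P where "P u v = (\<integral>\<omega>. (1 - cos (u * x \<omega>)) * (1 - cos (v * y \<omega>)) \<partial>M)" for u v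
  define P' where "P' u v = (\<integral>\<omega>. (1 - cos (u * x' \<omega>)) * (1 - cos (v * y' \<omega>)) \<partial>M')" for u v
  define d where "d = (a\<^sup>2 - a'\<^sup>2) / 2"
  have d: "0 < d" using less abs_le_square_iff[of a a'] by (simp add: d_def)
  have P'_nonneg: "0 \<le> P' u v" for u v
    unfolding P'_def by (intro integral_nonneg_AE) auto
  have P'_eq: "P' u v = 1 - exp (- u\<^sup>2 / 2) - exp (- v\<^sup>2 / 2) + exp (- u\<^sup>2 / 2) * exp (- v\<^sup>2 / 2) * cosh (a' * u * v)" for u v
    unfolding P'_def by (rule expectation_one_minus_cos_2[OF M' m' char'])
  have P_eq: "P u v = 1 - exp (- u\<^sup>2 / 2) - exp (- v\<^sup>2 / 2) + exp (- u\<^sup>2 / 2) * exp (- v\<^sup>2 / 2) * cosh (a * u * v)" for u v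
    unfolding P_def by (rule expectation_one_minus_cos_2[OF M m char])
  \<comment> \<open>If \<open>u\<close> or \<open>v\<close> is 0, both sides are 0: division by zero
    gives 0 and the weight vanishes there.\<close>
  have le: "P' u v / (u\<^sup>2 * v\<^sup>2) + d * g u * g v \<le> P u v / (u\<^sup>2 * v\<^sup>2)" for u v
  proof (cases "u = 0 \<or> v = 0")
    case False
    have "d * (u\<^sup>2 * v\<^sup>2) \<le> cosh (a * u * v) - cosh (a' * u * v)"
      using cosh_diff_ge[of "a' * u * v" "a * u * v"] less
      by (simp add: d_def abs_mult mult_right_mono power_mult_distrib algebra_simps)
    then have "exp (- u\<^sup>2 / 2) * exp (- v\<^sup>2 / 2) * (d * (u\<^sup>2 * v\<^sup>2)) \<le>
        exp (- u\<^sup>2 / 2) * exp (- v\<^sup>2 / 2) * (cosh (a * u * v) - cosh (a' * u * v))"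
      by (intro mult_left_mono) auto
    then have "P' u v + d * g u * g v * (u\<^sup>2 * v\<^sup>2) \<le> P u v"
      using False by (simp add: P_eq P'_eq g_def gauss_weight_def algebra_simps)
    then have "(P' u v + d * g u * g v * (u\<^sup>2 * v\<^sup>2)) / (u\<^sup>2 * v\<^sup>2) \<le> P u v / (u\<^sup>2 * v\<^sup>2)"
      by (rule divide_right_mono) simp
    then show ?thesis using False by (simp add: add_divide_distrib)
  qed (auto simp: g_def gauss_weight_def)
  let ?I = "\<integral>\<^sup>+\<omega>. ennreal \<bar>x \<omega> * y \<omega>\<bar> \<partial>M" and ?I' = "\<integral>\<^sup>+\<omega>. ennreal \<bar>x' \<omega> * y' \<omega>\<bar> \<partial>M'"
  let ?G = "\<integral>\<^sup>+u. ennreal (g u) \<partial>lborel"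
  have "?I' * abs_const ^ 2 + ennreal d * ?G ^ 2
    = (\<integral>\<^sup>+v. \<integral>\<^sup>+u. ennreal (P' u v / (u\<^sup>2 * v\<^sup>2)) + ennreal (d * g u * g v) \<partial>lborel \<partial>lborel)"
  proof -
    have "(\<integral>\<^sup>+v. \<integral>\<^sup>+u. ennreal (P' u v / (u\<^sup>2 * v\<^sup>2)) + ennreal (d * g u * g v) \<partial>lborel \<partial>lborel)
      = (\<integral>\<^sup>+v. \<integral>\<^sup>+u. ennreal (P' u v / (u\<^sup>2 * v\<^sup>2)) \<partial>lborel \<partial>lborel)
        + (\<integral>\<^sup>+v. \<integral>\<^sup>+u. ennreal (d * g u * g v) \<partial>lborel \<partial>lborel)"
      \<comment> \<open>The closed form of \<open>P'\<close> makes the integrand visibly measurable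
        in \<open>u\<close> and \<open>v\<close>.\<close>
      by (simp add: nn_integral_add P'_eq cosh_field_def)
    also have "(\<integral>\<^sup>+v. \<integral>\<^sup>+u. ennreal (d * g u * g v) \<partial>lborel \<partial>lborel) = ennreal d * ?G ^ 2"
      using d g by (simp add: ennreal_mult nn_integral_cmult nn_integral_multc power2_eq_square mult.assoc)
    finally show ?thesis
      by (simp add: abs_pair_moment_eq_integral[OF M' m'] P'_def)
  qed
  also have "\<dots> \<le> (\<integral>\<^sup>+v. \<integral>\<^sup>+u. ennreal (P u v / (u\<^sup>2 * v\<^sup>2)) \<partial>lborel \<partial>lborel)"
    using le d g P'_nonneg by (intro nn_integral_mono) (auto intro!: ennreal_leI simp flip: ennreal_plus)
  also have "\<dots> = ?I * abs_const ^ 2"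
    by (simp add: abs_pair_moment_eq_integral[OF M m] P_def)
  finally have upper: "?I' * abs_const ^ 2 + ennreal d * ?G ^ 2 \<le> ?I * abs_const ^ 2" .
  assume "\<not> (\<integral>\<omega>. \<bar>x' \<omega> * y' \<omega>\<bar> \<partial>M') < (\<integral>\<omega>. \<bar>x \<omega> * y \<omega>\<bar> \<partial>M)"
  then have "?I \<le> ?I'"
    by (simp add: nn_integral_eq_integral int ennreal_leI)
  then have "?I * abs_const ^ 2 \<le> ?I' * abs_const ^ 2" by (rule mult_right_mono) simp
  from order_trans[OF add_right_mono[OF this] upper]
  have "?I * abs_const ^ 2 + ennreal d * ?G ^ 2 \<le> ?I * abs_const ^ 2 + 0" by simp
  \<comment> \<open>Cancellation in \<open>ennreal\<close> requires a finite summand; this is where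
    integrability of the product and finiteness of \<open>abs_const\<close> enter.\<close>
  moreover have "?I * abs_const ^ 2 < \<infinity>"
    using abs_const_finite
    by (simp add: nn_integral_eq_integral int ennreal_mult_less_top power_less_top_ennreal)
  ultimately have "ennreal d * ?G ^ 2 \<le> 0"
    by (auto simp: ennreal_add_left_cancel_le)
  then show False using d g0 by simp
qed

section \<open>Triple moments and the sign of the product of correlations\<close>

text \<open>\<open>sinh\<close> preserves signs and does not decrease absolute values, so the
  inequality is one between products of absolute values.\<close>

lemma mult3_le_sinh:
  fixes p q r :: real
  assumes "0 \<le> p * q * r"
  shows "p * q * r \<le> sinh p * sinh q * sinh r"
proof -
  have sg: "sgn (sinh t) = sgn t" for t :: real
    by (simp add: sgn_if)
  have "sgn (sinh p * sinh q * sinh r) = sgn (p * q * r)"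
    by (simp add: sgn_mult sg)
  then have "0 \<le> sinh p * sinh q * sinh r"
    using assms by (metis sgn_less linorder_not_le)
  have "p * q * r = \<bar>p\<bar> * \<bar>q\<bar> * \<bar>r\<bar>"
    using assms by (simp flip: abs_mult)
  also have "\<dots> \<le> \<bar>sinh p\<bar> * \<bar>sinh q\<bar> * \<bar>sinh r\<bar>"
    by (intro mult_mono abs_le_abs_sinh) auto
  also have "\<dots> = sinh p * sinh q * sinh r"
    using \<open>0 \<le> sinh p * sinh q * sinh r\<close> by (simp flip: abs_mult)
  finally show ?thesis .
qed

text \<open>With equal absolute correlations all \<open>cosh\<close> terms agree, and the
  \<open>sinh\<close> products are opposite. The resulting gap is bounded below by a multiple of the
  product weight, as for pairs.\<close>

lemma abs_triple_moment_less_if_sign: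
  fixes x y z :: "'a \<Rightarrow> real" and x' y' z' :: "'b \<Rightarrow> real"
  assumes M: "prob_space M"
    and m: "x \<in> borel_measurable M" "y \<in> borel_measurable M" "z \<in> borel_measurable M"
    and char: "\<And>u v w. (\<integral>\<omega>. cos (u * x \<omega> + v * y \<omega> + w * z \<omega>) \<partial>M)
      = exp (- (u\<^sup>2 + v\<^sup>2 + w\<^sup>2 + 2 * (a * u * v) + 2 * (b * u * w) + 2 * (c * v * w)) / 2)"
    and M': "prob_space M'"
    and m': "x' \<in> borel_measurable M'" "y' \<in> borel_measurable M'" "z' \<in> borel_measurable M'"
    and char': "\<And>u v w. (\<integral>\<omega>. cos (u * x' \<omega> + v * y' \<omega> + w * z' \<omega>) \<partial>M')
      = exp (- (u\<^sup>2 + v\<^sup>2 + w\<^sup>2 + 2 * (a' * u * v) + 2 * (b' * u * w) + 2 * (c' * v * w)) / 2)"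
    and int: "integrable M (\<lambda>\<omega>. \<bar>x \<omega> * y \<omega> * z \<omega>\<bar>)" "integrable M' (\<lambda>\<omega>. \<bar>x' \<omega> * y' \<omega> * z' \<omega>\<bar>)"
    and abs_eq: "\<bar>a'\<bar> = \<bar>a\<bar>" "\<bar>b'\<bar> = \<bar>b\<bar>" "\<bar>c'\<bar> = \<bar>c\<bar>"
    and pos: "0 < a * b * c" and neg: "a' * b' * c' < 0"
  shows "(\<integral>\<omega>. \<bar>x' \<omega> * y' \<omega> * z' \<omega>\<bar> \<partial>M') < (\<integral>\<omega>. \<bar>x \<omega> * y \<omega> * z \<omega>\<bar> \<partial>M)"
proof (rule ccontr)
  define g where "g = gauss_weight"
  have g[measurable]: "g \<in> borel_measurable borel" "\<And>u. 0 \<le> g u"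
    and g0: "(\<integral>\<^sup>+u. ennreal (g u) \<partial>lborel) \<noteq> 0"
    by (auto simp: g_def gauss_weight_integral_pos)
  define P where "P u v w = (\<integral>\<omega>. (1 - cos (u * x \<omega>)) * (1 - cos (v * y \<omega>)) * (1 - cos (w * z \<omega>)) \<partial>M)" for u v w
  define P' where "P' u v w = (\<integral>\<omega>. (1 - cos (u * x' \<omega>)) * (1 - cos (v * y' \<omega>)) * (1 - cos (w * z' \<omega>)) \<partial>M')" for u v w
  \<comment> \<open>The factor 2 arises because the two \<open>sinh\<close> products are negatives
    of each other.\<close>
  define d where "d = 2 * (a * b * c)"
  have d: "0 < d" using pos by (simp add: d_def)
  have P'_nonneg: "0 \<le> P' u v w" for u v w
    unfolding P'_def by (intro integral_nonneg_AE) auto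
  note P'_eq = expectation_one_minus_cos_3[OF M' m' char', folded P'_def]
  note P_eq = expectation_one_minus_cos_3[OF M m char, folded P_def]
  have diff: "P u v w = P' u v w + exp (- u\<^sup>2 / 2) * exp (- v\<^sup>2 / 2) * exp (- w\<^sup>2 / 2)
      * (2 * (sinh (a * u * v) * sinh (b * u * w) * sinh (c * v * w)))" for u v w
  proof -
    have "cosh (p' * s * t) = cosh (p * s * t)" if "\<bar>p'\<bar> = \<bar>p\<bar>" for p p' s t :: real
      using that by (auto simp: abs_eq_iff)
    note cosh = this[OF abs_eq(1)] this[OF abs_eq(2)] this[OF abs_eq(3)]
    have "(a' = a \<or> a' = -a) \<and> (b' = b \<or> b' = -b) \<and> (c' = c \<or> c' = -c)"
      using abs_eq by (auto simp: abs_eq_iff)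
    \<comment> \<open>Since \<open>a * b * c\<close> and \<open>a' * b' * c'\<close> have opposite
      signs, an odd number of the three correlations is negated.\<close>
    then have sinh: "sinh (a' * u * v) * sinh (b' * u * w) * sinh (c' * v * w)
        = - (sinh (a * u * v) * sinh (b * u * w) * sinh (c * v * w))"
      using pos neg by (elim conjE disjE) auto
    show ?thesis unfolding P_eq P'_eq cosh sinh by (simp add: algebra_simps)
  qed
  have le: "P' u v w / (u\<^sup>2 * v\<^sup>2 * w\<^sup>2) + d * g u * g v * g w \<le> P u v w / (u\<^sup>2 * v\<^sup>2 * w\<^sup>2)" for u v w
  proof (cases "u = 0 \<or> v = 0 \<or> w = 0")
    case False
    have prod: "(a * u * v) * (b * u * w) * (c * v * w) = a * b * c * (u\<^sup>2 * v\<^sup>2 * w\<^sup>2)"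
      by (simp add: power2_eq_square mult_ac)
    have "d * (u\<^sup>2 * v\<^sup>2 * w\<^sup>2) \<le> 2 * (sinh (a * u * v) * sinh (b * u * w) * sinh (c * v * w))"
      using mult3_le_sinh[of "a * u * v" "b * u * w" "c * v * w", unfolded prod] pos
      by (simp add: d_def)
    then have "exp (- u\<^sup>2 / 2) * exp (- v\<^sup>2 / 2) * exp (- w\<^sup>2 / 2) * (d * (u\<^sup>2 * v\<^sup>2 * w\<^sup>2)) \<le>
        exp (- u\<^sup>2 / 2) * exp (- v\<^sup>2 / 2) * exp (- w\<^sup>2 / 2)
          * (2 * (sinh (a * u * v) * sinh (b * u * w) * sinh (c * v * w)))"
      by (intro mult_left_mono) auto
    then have "P' u v w + d * g u * g v * g w * (u\<^sup>2 * v\<^sup>2 * w\<^sup>2) \<le> P u v w"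
      unfolding diff using False by (simp add: g_def gauss_weight_def mult_ac)
    then have "(P' u v w + d * g u * g v * g w * (u\<^sup>2 * v\<^sup>2 * w\<^sup>2)) / (u\<^sup>2 * v\<^sup>2 * w\<^sup>2) \<le> P u v w / (u\<^sup>2 * v\<^sup>2 * w\<^sup>2)"
      by (rule divide_right_mono) simp
    then show ?thesis using False by (simp add: add_divide_distrib)
  qed (auto simp: g_def gauss_weight_def)
  let ?I = "\<integral>\<^sup>+\<omega>. ennreal \<bar>x \<omega> * y \<omega> * z \<omega>\<bar> \<partial>M" and ?I' = "\<integral>\<^sup>+\<omega>. ennreal \<bar>x' \<omega> * y' \<omega> * z' \<omega>\<bar> \<partial>M'"
  let ?G = "\<integral>\<^sup>+u. ennreal (g u) \<partial>lborel"
  have "?I' * abs_const ^ 3 + ennreal d * ?G ^ 3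
    = (\<integral>\<^sup>+w. \<integral>\<^sup>+v. \<integral>\<^sup>+u. ennreal (P' u v w / (u\<^sup>2 * v\<^sup>2 * w\<^sup>2)) + ennreal (d * g u * g v * g w) \<partial>lborel \<partial>lborel \<partial>lborel)"
  proof -
    have "(\<integral>\<^sup>+w. \<integral>\<^sup>+v. \<integral>\<^sup>+u. ennreal (P' u v w / (u\<^sup>2 * v\<^sup>2 * w\<^sup>2)) + ennreal (d * g u * g v * g w) \<partial>lborel \<partial>lborel \<partial>lborel)
      = (\<integral>\<^sup>+w. \<integral>\<^sup>+v. \<integral>\<^sup>+u. ennreal (P' u v w / (u\<^sup>2 * v\<^sup>2 * w\<^sup>2)) \<partial>lborel \<partial>lborel \<partial>lborel)
        + (\<integral>\<^sup>+w. \<integral>\<^sup>+v. \<integral>\<^sup>+u. ennreal (d * g u * g v * g w) \<partial>lborel \<partial>lborel \<partial>lborel)"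
      by (simp add: nn_integral_add P'_eq cosh_field_def sinh_field_def)
    also have "(\<integral>\<^sup>+w. \<integral>\<^sup>+v. \<integral>\<^sup>+u. ennreal (d * g u * g v * g w) \<partial>lborel \<partial>lborel \<partial>lborel) = ennreal d * ?G ^ 3"
      using d g by (simp add: ennreal_mult nn_integral_cmult nn_integral_multc power3_eq_cube mult.assoc)
    finally show ?thesis
      by (simp add: abs_triple_moment_eq_integral[OF M' m'] P'_def)
  qed
  also have "\<dots> \<le> (\<integral>\<^sup>+w. \<integral>\<^sup>+v. \<integral>\<^sup>+u. ennreal (P u v w / (u\<^sup>2 * v\<^sup>2 * w\<^sup>2)) \<partial>lborel \<partial>lborel \<partial>lborel)"
    using le d g P'_nonneg by (intro nn_integral_mono) (auto intro!: ennreal_leI simp flip: ennreal_plus)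
  also have "\<dots> = ?I * abs_const ^ 3"
    by (simp add: abs_triple_moment_eq_integral[OF M m] P_def)
  finally have upper: "?I' * abs_const ^ 3 + ennreal d * ?G ^ 3 \<le> ?I * abs_const ^ 3" .
  assume "\<not> (\<integral>\<omega>. \<bar>x' \<omega> * y' \<omega> * z' \<omega>\<bar> \<partial>M') < (\<integral>\<omega>. \<bar>x \<omega> * y \<omega> * z \<omega>\<bar> \<partial>M)"
  then have "?I \<le> ?I'"
    by (simp add: nn_integral_eq_integral int ennreal_leI)
  then have "?I * abs_const ^ 3 \<le> ?I' * abs_const ^ 3" by (rule mult_right_mono) simp
  from order_trans[OF add_right_mono[OF this] upper]
  have "?I * abs_const ^ 3 + ennreal d * ?G ^ 3 \<le> ?I * abs_const ^ 3 + 0" by simp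
  moreover have "?I * abs_const ^ 3 < \<infinity>"
    using abs_const_finite
    by (simp add: nn_integral_eq_integral int ennreal_mult_less_top power_less_top_ennreal)
  ultimately have "ennreal d * ?G ^ 3 \<le> 0"
    by (auto simp: ennreal_add_left_cancel_le)
  then show False using d g0 by simp
qed

section \<open>Standard Gaussian vectors\<close>

text \<open>Zero expectation forces \<mu> to be 0 in both cases. The degenerate case occurs for
  linear combinations when the correlation matrix is singular.\<close>

lemma (in prob_space) centered_gaussian_cases:
  assumes "gaussian_rv M Y" and "expectation Y = 0"
  obtains "Y \<in> borel_measurable M" "AE \<omega> in M. Y \<omega> = 0"
  | \<sigma> where "Y \<in> borel_measurable M" "0 < \<sigma>"
      "distributed M lborel Y (\<lambda>x. ennreal (normal_density 0 \<sigma> x))"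
proof -
  have [measurable]: "Y \<in> borel_measurable M" using assms by (simp add: gaussian_rv_def)
  consider \<mu> where "AE \<omega> in M. Y \<omega> = \<mu>"
    | \<mu> \<sigma> where "0 < \<sigma>" "distributed M lborel Y (\<lambda>x. ennreal (normal_density \<mu> \<sigma> x))"
    using assms(1) by (auto simp: gaussian_rv_def)
  then show ?thesis
  proof cases
    case 1
    have "expectation Y = (\<integral>\<omega>. \<mu> \<partial>M)" using 1 by (intro integral_cong_AE) auto
    then have "\<mu> = 0" using assms(2) by (simp add: prob_space)
    with 1 show ?thesis by (intro that(1)) auto
  next
    case 2
    then have "\<mu> = 0" using normal_distributed_expectation assms(2) by auto
    with 2 show ?thesis by (intro that(2)) auto
  qed
qed

lemma (in prob_space) integrable_abs_power_gaussian:
  assumes "gaussian_rv M Y" and "expectation Y = 0"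
  shows "integrable M (\<lambda>\<omega>. \<bar>Y \<omega>\<bar> ^ n)"
  using assms
proof (cases rule: centered_gaussian_cases)
  case 1
  have "AE \<omega> in M. \<bar>Y \<omega>\<bar> ^ n = 0 ^ n" using 1(2) by eventually_elim simp
  then show ?thesis
    using 1(1) by (subst integrable_cong_AE[where g = "\<lambda>_. 0 ^ n"]) auto
next
  case (2 \<sigma>)
  show ?thesis
    using integrable_normal_moment_abs[OF 2(2), of 0 n]
    by (subst distributed_integrable[OF 2(3), of "\<lambda>x. \<bar>x\<bar> ^ n", symmetric]) auto
qed

text \<open>The real part of the characteristic function at 1. Writing the variance as a second
  moment covers the point mass and the density case by one formula.\<close>

lemma (in prob_space) expectation_cos_gaussian:
  assumes "gaussian_rv M Y" and "expectation Y = 0"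
  shows "expectation (\<lambda>\<omega>. cos (Y \<omega>)) = exp (- expectation (\<lambda>\<omega>. (Y \<omega>)\<^sup>2) / 2)"
  using assms
proof (cases rule: centered_gaussian_cases)
  case 1
  have "expectation (\<lambda>\<omega>. cos (Y \<omega>)) = (\<integral>\<omega>. 1 \<partial>M)" "expectation (\<lambda>\<omega>. (Y \<omega>)\<^sup>2) = (\<integral>\<omega>. 0 \<partial>M)"
    using 1(1) by (intro integral_cong_AE; use 1(2) in auto)+
  then show ?thesis by (simp add: prob_space)
next
  case (2 \<sigma>)
  note [measurable] = 2(1)
  have var: "expectation (\<lambda>\<omega>. (Y \<omega>)\<^sup>2) = \<sigma>\<^sup>2"
    using normal_distributed_variance[OF 2(2,3)] assms(2) by simp
  have "distributed M lborel (\<lambda>\<omega>. Y \<omega> / \<sigma>) std_normal_density"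
    using normal_standard_normal_convert[OF 2(2), of Y 0] 2(3) by simp
  then have D: "distr M lborel (\<lambda>\<omega>. Y \<omega> / \<sigma>) = density lborel std_normal_density"
    by (rule distributed_distr_eq_density)
  \<comment> \<open>\<open>Y\<close> is \<sigma> times its standardization, so the value at 1 is the
    standard normal characteristic function at \<sigma>.\<close>
  have "char (density lborel std_normal_density) \<sigma> = (CLINT \<omega>|M. iexp (Y \<omega>))"
    unfolding char_def D[symmetric] using 2(2) by (subst integral_distr) auto
  then have "(CLINT \<omega>|M. iexp (Y \<omega>)) = complex_of_real (exp (- \<sigma>\<^sup>2 / 2))"
    by (simp add: char_std_normal_distribution)
  moreover have "integrable M (\<lambda>\<omega>. iexp (Y \<omega>))"
    by (intro integrable_const_bound[where B = 1]) auto
  ultimately have "expectation (\<lambda>\<omega>. Re (iexp (Y \<omega>))) = exp (- \<sigma>\<^sup>2 / 2)"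
    using integral_Re by (metis Re_complex_of_real)
  then show ?thesis by (simp add: var Re_exp)
qed

context
  fixes M :: "'a measure" and X :: "'a \<Rightarrow> real ^ 'n" and \<Sigma> :: "real ^ 'n ^ 'n"
  assumes std: "standard_gaussian_vector M X \<Sigma>"
begin

lemma std_gaussian_prob_space: "prob_space M"
  using std by (simp add: standard_gaussian_vector_def gaussian_vector_def)

lemma std_gaussian_measurable: "(\<lambda>\<omega>. X \<omega> $ i) \<in> borel_measurable M"
proof -
  have "(\<lambda>\<omega>. axis i 1 \<bullet> X \<omega>) \<in> borel_measurable M"
    using std by (auto simp: standard_gaussian_vector_def gaussian_vector_def gaussian_rv_def)
  then show ?thesis by (simp add: inner_axis')
qed

lemma std_gaussian_coord: "gaussian_rv M (\<lambda>\<omega>. X \<omega> $ i)" "(\<integral>\<omega>. X \<omega> $ i \<partial>M) = 0"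
proof -
  have "gaussian_rv M (\<lambda>\<omega>. axis i 1 \<bullet> X \<omega>)"
    using std by (auto simp: standard_gaussian_vector_def gaussian_vector_def)
  then show "gaussian_rv M (\<lambda>\<omega>. X \<omega> $ i)" by (simp add: inner_axis')
  show "(\<integral>\<omega>. X \<omega> $ i \<partial>M) = 0" using std by (simp add: standard_gaussian_vector_def)
qed

lemma std_gaussian_integrable_power: "integrable M (\<lambda>\<omega>. \<bar>X \<omega> $ i\<bar> ^ n)"
  by (intro prob_space.integrable_abs_power_gaussian std_gaussian_prob_space std_gaussian_coord)

lemma std_gaussian_integrable: "integrable M (\<lambda>\<omega>. X \<omega> $ i)"
  using std_gaussian_integrable_power[of i 1] std_gaussian_measurable
  by (simp add: integrable_abs_iff)

lemma std_gaussian_integrable_mult: "integrable M (\<lambda>\<omega>. X \<omega> $ i * X \<omega> $ j)"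
proof (rule Bochner_Integration.integrable_bound)
  show "integrable M (\<lambda>\<omega>. \<bar>X \<omega> $ i\<bar> ^ 2 + \<bar>X \<omega> $ j\<bar> ^ 2)"
    by (intro Bochner_Integration.integrable_add std_gaussian_integrable_power)
  have "\<bar>s * t\<bar> \<le> s\<^sup>2 + t\<^sup>2" for s t :: real
    using sum_squares_bound[of "\<bar>s\<bar>" "\<bar>t\<bar>"] mult_nonneg_nonneg[OF abs_ge_zero[of s] abs_ge_zero[of t]]
    unfolding abs_mult power2_abs by linarith
  then show "AE \<omega> in M. norm (X \<omega> $ i * X \<omega> $ j) \<le> norm (\<bar>X \<omega> $ i\<bar> ^ 2 + \<bar>X \<omega> $ j\<bar> ^ 2)"
    by simp
qed (intro borel_measurable_times std_gaussian_measurable)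

text \<open>Each absolute factor is at most the largest of the three, whose cube is at most the sum
  of the cubes.\<close>

lemma std_gaussian_integrable_mult3: "integrable M (\<lambda>\<omega>. X \<omega> $ i * X \<omega> $ j * X \<omega> $ k)"
proof (rule Bochner_Integration.integrable_bound)
  let ?f = "\<lambda>\<omega>. \<bar>X \<omega> $ i\<bar> ^ 3 + \<bar>X \<omega> $ j\<bar> ^ 3 + \<bar>X \<omega> $ k\<bar> ^ 3"
  show "integrable M ?f"
    by (intro Bochner_Integration.integrable_add std_gaussian_integrable_power)
  have "r * s * t \<le> r ^ 3 + s ^ 3 + t ^ 3" if "0 \<le> r" "0 \<le> s" "0 \<le> t" for r s t :: real
  proof -
    let ?m = "max r (max s t)"
    have "r * s * t \<le> ?m * ?m * ?m" using that by (intro mult_mono) auto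
    also have "\<dots> \<le> r ^ 3 + s ^ 3 + t ^ 3" using that by (auto simp: max_def power3_eq_cube)
    finally show ?thesis .
  qed
  then show "AE \<omega> in M. norm (X \<omega> $ i * X \<omega> $ j * X \<omega> $ k) \<le> norm (?f \<omega>)"
    by (auto simp: abs_mult)
qed (intro borel_measurable_times std_gaussian_measurable)

lemma std_gaussian_second_moment: "(\<integral>\<omega>. X \<omega> $ i * X \<omega> $ j \<partial>M) = \<Sigma> $ i $ j"
  using std by (auto simp: standard_gaussian_vector_def correlation_matrix_def covariance_def)

lemma std_gaussian_diag: "\<Sigma> $ i $ i = 1"
proof -
  have "(\<integral>\<omega>. (X \<omega> $ i - (\<integral>\<omega>. X \<omega> $ i \<partial>M))\<^sup>2 \<partial>M) = 1"
    using std unfolding standard_gaussian_vector_def by blast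
  then show ?thesis
    using std_gaussian_second_moment[of i i] by (simp add: std_gaussian_coord power2_eq_square)
qed

lemma std_gaussian_sym: "\<Sigma> $ i $ j = \<Sigma> $ j $ i"
  by (simp add: mult.commute flip: std_gaussian_second_moment)

text \<open>The combination is again a centered Gaussian variable, so only its second moment
  matters, and this is a quadratic form in the entries of \<Sigma>. The indices may coincide and the
  form may degenerate.\<close>

lemma std_gaussian_expectation_cos_3:
  "(\<integral>\<omega>. cos (u * X \<omega> $ i + v * X \<omega> $ j + w * X \<omega> $ k) \<partial>M)
    = exp (- (u\<^sup>2 + v\<^sup>2 + w\<^sup>2 + 2 * (\<Sigma> $ i $ j * u * v) + 2 * (\<Sigma> $ i $ k * u * w)
        + 2 * (\<Sigma> $ j $ k * v * w)) / 2)"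
proof -
  let ?Y = "\<lambda>\<omega>. u * X \<omega> $ i + v * X \<omega> $ j + w * X \<omega> $ k"
  have "gaussian_rv M (\<lambda>\<omega>. (u *\<^sub>R axis i 1 + v *\<^sub>R axis j 1 + w *\<^sub>R axis k 1) \<bullet> X \<omega>)"
    using std unfolding standard_gaussian_vector_def gaussian_vector_def by blast
  then have g: "gaussian_rv M ?Y"
    by (simp add: inner_add_left inner_axis')
  have m: "(\<integral>\<omega>. ?Y \<omega> \<partial>M) = 0"
    by (simp add: std_gaussian_integrable std_gaussian_coord)
  have "(?Y \<omega>)\<^sup>2 = u\<^sup>2 * (X \<omega> $ i * X \<omega> $ i) + v\<^sup>2 * (X \<omega> $ j * X \<omega> $ j) + w\<^sup>2 * (X \<omega> $ k * X \<omega> $ k)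
      + 2 * (u * v) * (X \<omega> $ i * X \<omega> $ j) + 2 * (u * w) * (X \<omega> $ i * X \<omega> $ k)
      + 2 * (v * w) * (X \<omega> $ j * X \<omega> $ k)" for \<omega>
    by (simp add: power2_eq_square algebra_simps)
  then have "(\<integral>\<omega>. (?Y \<omega>)\<^sup>2 \<partial>M) = u\<^sup>2 * \<Sigma> $ i $ i + v\<^sup>2 * \<Sigma> $ j $ j + w\<^sup>2 * \<Sigma> $ k $ k
      + 2 * (u * v) * \<Sigma> $ i $ j + 2 * (u * w) * \<Sigma> $ i $ k + 2 * (v * w) * \<Sigma> $ j $ k"
    by (simp add: std_gaussian_integrable_mult std_gaussian_second_moment)
  then have "(\<integral>\<omega>. (?Y \<omega>)\<^sup>2 \<partial>M) = u\<^sup>2 + v\<^sup>2 + w\<^sup>2 + 2 * (\<Sigma> $ i $ j * u * v)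
      + 2 * (\<Sigma> $ i $ k * u * w) + 2 * (\<Sigma> $ j $ k * v * w)"
    by (simp add: std_gaussian_diag mult_ac)
  then show ?thesis
    using prob_space.expectation_cos_gaussian[OF std_gaussian_prob_space g m] by simp
qed

lemma std_gaussian_expectation_cos_2:
  "(\<integral>\<omega>. cos (u * X \<omega> $ i + v * X \<omega> $ j) \<partial>M)
    = exp (- (u\<^sup>2 + v\<^sup>2 + 2 * (\<Sigma> $ i $ j * u * v)) / 2)"
  using std_gaussian_expectation_cos_3[of u i v j 0 i] by simp

end

section \<open>Cycles, coboundaries and sign conjugacy\<close>

lemma bit_add_self [simp]: "b + b = (0::bit)"
  by (cases b) simp_all

lemma sum_three:
  fixes f :: "'a \<Rightarrow> 'b::comm_monoid_add"
  assumes "a \<noteq> b" "b \<noteq> c" "a \<noteq> c"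
  shows "sum f {a, b, c} = f a + f b + f c"
  using assms by (simp add: add.assoc)

text \<open>Pairing with \<open>s\<close> is a linear functional on chains. It vanishes on
  triangles, hence on all cycles, so its value on a chain joining two vertices depends only on these
  vertices and yields a potential \<open>p\<close>.\<close>

lemma coboundary_if_triangles_generate_cycles:
  fixes E :: "'n::finite set set" and s :: "'n set \<Rightarrow> bit"
  assumes gen: "triangle_space E = cycle_space E"
    and tri: "\<And>i j k. i \<noteq> j \<Longrightarrow> j \<noteq> k \<Longrightarrow> i \<noteq> k \<Longrightarrow> {i, j} \<in> E \<Longrightarrow> {j, k} \<in> E \<Longrightarrow> {i, k} \<in> E
      \<Longrightarrow> s {i, j} + s {j, k} + s {i, k} = 0"
  obtains p :: "'n \<Rightarrow> bit" where "\<And>i j. i \<noteq> j \<Longrightarrow> {i, j} \<in> E \<Longrightarrow> s {i, j} = p i + p j"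
proof -
  define L where "L f = (\<Sum>e\<in>UNIV. f $ e * s e)" for f :: "bit ^ ('n set)"
  have L_add: "L (f + g) = L f + L g" for f g
    unfolding L_def sum.distrib[symmetric] by (simp only: vector_add_component distrib_right)
  have L_0: "L 0 = 0"
    unfolding L_def by simp
  have L_scale: "L (c *s f) = c * L f" for c f
    unfolding L_def sum_distrib_left by (simp only: vector_smult_component mult.assoc)
  have L_cycle: "L f = 0" if "f \<in> cycle_space E" for f
  proof -
    have "L (triangle_chain i j k) = 0"
      if "i \<noteq> j" "j \<noteq> k" "i \<noteq> k" "{i, j} \<in> E" "{j, k} \<in> E" "{i, k} \<in> E" for i j k
    proof -
      have "L (triangle_chain i j k) = (\<Sum>e\<in>UNIV. if e \<in> {{i, j}, {j, k}, {i, k}} then s e else 0)"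
        unfolding L_def triangle_chain_def by (intro sum.cong) auto
      also have "\<dots> = (\<Sum>e\<in>{{i, j}, {j, k}, {i, k}}. s e)"
        by (subst sum.inter_restrict[symmetric]) auto
      also have "\<dots> = s {i, j} + s {j, k} + s {i, k}"
        by (rule sum_three) (use that in \<open>auto simp: doubleton_eq_iff\<close>)
      also have "\<dots> = 0" by (rule tri) (fact that)+
      finally show ?thesis .
    qed
    then have "triangle_space E \<subseteq> {f. L f = 0}"
      unfolding triangle_space_def
      by (intro vec.span_minimal)
        (auto simp: vec.subspace_def L_add L_scale L_0)
    then show ?thesis using gen that by blast
  qed
  define bd where "bd f v = (\<Sum>e\<in>{e \<in> E. v \<in> e}. f $ e)" for f :: "bit ^ ('n set)" and v
  have bd_add: "bd (f + g) v = bd f v + bd g v" for f g v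
    unfolding bd_def sum.distrib[symmetric] by (intro sum.cong refl vector_add_component)
  \<comment> \<open>Chains with boundary \<open>v + w\<close> play the role of walks from \<open>v\<close> to \<open>w\<close>.\<close>
  define joins where "joins f v w \<longleftrightarrow> (\<forall>e. e \<notin> E \<longrightarrow> f $ e = 0) \<and>
    (\<forall>x. bd f x = of_bool (x = v) + of_bool (x = w))" for f v w
  \<comment> \<open>Both chains have the endpoint \<open>u\<close>; its two contributions to the
    boundary cancel in characteristic two.\<close>
  have joins_add: "joins (f + g) v w" if "joins f u v" "joins g u w" for f g u v w
    using that by (auto simp: joins_def bd_add)
  have joins_sym: "joins f w v" if "joins f v w" for f v w
    using that by (simp add: joins_def add.commute)
  have joins_refl: "joins 0 v v" for v
    by (simp add: joins_def bd_def)
  have joins_edge: "joins (axis {v, w} 1) v w" if "v \<noteq> w" "{v, w} \<in> E" for v w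
  proof -
    have "bd (axis {v, w} 1) x = of_bool (x = v) + of_bool (x = w)" for x
    proof -
      have "bd (axis {v, w} 1) x = (\<Sum>e\<in>{e \<in> E. x \<in> e}. if e = {v, w} then 1 else 0)"
        unfolding bd_def by (intro sum.cong) (auto simp: axis_def)
      also have "\<dots> = (if x \<in> {v, w} then 1 else 0)"
        using that by (subst sum.delta) auto
      finally show ?thesis using that by auto
    qed
    then show ?thesis using that by (auto simp: joins_def axis_def)
  qed
  \<comment> \<open>Vertices of one component share their \<open>root\<close>, and \<open>p v\<close> is the value of \<open>s\<close> on a chain from \<open>v\<close> to it.\<close>
  define root where "root v = (SOME w. \<exists>f. joins f v w)" for v
  have "\<exists>f. joins f v (root v)" for v
    unfolding root_def by (rule someI[of "\<lambda>w. \<exists>f. joins f v w" v]) (use joins_refl in blast)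
  then obtain F where F: "joins (F v) v (root v)" for v by metis
  have root_eq: "root v = root w" if "joins f v w" for f v w
  proof -
    \<comment> \<open>Joined vertices reach the same vertices, so the choice operator in
      \<open>root\<close> is applied to equal predicates.\<close>
    have "(\<exists>f. joins f v x) \<longleftrightarrow> (\<exists>f. joins f w x)" for x
      using that joins_add joins_sym by blast
    then show ?thesis by (simp add: root_def)
  qed
  have "s {v, w} = L (F v) + L (F w)" if "v \<noteq> w" "{v, w} \<in> E" for v w
  proof -
    let ?c = "axis {v, w} 1 :: bit ^ ('n set)"
    have "joins (?c + F v) w (root v)"
      by (rule joins_add[OF joins_edge[OF that] F])
    moreover have "joins (F w) w (root v)"
      using F[of w] root_eq[OF joins_edge[OF that]] by simp
    \<comment> \<open>Two chains with the same endpoints: their sum has zero boundary, so it is a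
      cycle and \<open>L\<close> kills it.\<close>
    ultimately have "joins ((?c + F v) + F w) (root v) (root v)"
      by (rule joins_add)
    then have "L ((?c + F v) + F w) = 0"
      by (intro L_cycle) (simp add: joins_def cycle_space_def bd_def)
    moreover have "L ?c = s {v, w}"
    proof -
      have "L ?c = (\<Sum>e\<in>UNIV. if e = {v, w} then s e else 0)"
        unfolding L_def by (intro sum.cong) (auto simp: axis_def)
      then show ?thesis by simp
    qed
    ultimately have "s {v, w} + (L (F v) + L (F w)) = 0"
      by (simp add: L_add add.assoc)
    then show ?thesis
      by (metis add.assoc add.right_neutral bit_add_self)
  qed
  then show ?thesis by (rule that)
qed

section \<open>Counting the labels\<close>

text \<open>Increasing pairs correspond to two-element subsets, each listed by its minimum and
  maximum.\<close>

lemma card_less_pairs: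
  fixes A :: "'a::linorder set"
  assumes "finite A"
  shows "card {(i, j). i \<in> A \<and> j \<in> A \<and> i < j} = card A choose 2"
proof -
  have "bij_betw (\<lambda>(i, j). {i, j}) {(i, j). i \<in> A \<and> j \<in> A \<and> i < j} {B. B \<subseteq> A \<and> card B = 2}"
    unfolding bij_betw_def
  proof
    show "inj_on (\<lambda>(i, j). {i, j}) {(i, j). i \<in> A \<and> j \<in> A \<and> i < j}"
      by (auto simp: inj_on_def doubleton_eq_iff)
    show "(\<lambda>(i, j). {i, j}) ` {(i, j). i \<in> A \<and> j \<in> A \<and> i < j} = {B. B \<subseteq> A \<and> card B = 2}"
    proof (intro equalityI subsetI)
      fix B assume "B \<in> {B. B \<subseteq> A \<and> card B = 2}"
      then obtain x y where "B = {x, y}" "x \<noteq> y" "B \<subseteq> A"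
        by (auto simp: card_2_iff)
      then have "B = {min x y, max x y}" "min x y < max x y" "min x y \<in> A" "max x y \<in> A"
        by (auto simp: min_def max_def)
      then show "B \<in> (\<lambda>(i, j). {i, j}) ` {(i, j). i \<in> A \<and> j \<in> A \<and> i < j}"
        by (intro image_eqI[of _ _ "(min x y, max x y)"]) auto
    qed auto
  qed
  then show ?thesis
    using n_subsets[OF assms, of 2] by (simp add: bij_betw_same_card)
qed

lemma card_pair_labels: "card (pair_labels :: ('n::{finite,linorder} \<times> 'n) set) = CARD('n) choose 2"
  using card_less_pairs[of "UNIV :: 'n set"] by (simp add: pair_labels_def)

text \<open>Lying above the minimum means differing from it, so the last two indices form an
  increasing pair in a set with one element fewer.\<close>

lemma card_anchored_triple_labels:
  "card (anchored_triple_labels :: ('n::{finite,linorder} \<times> 'n \<times> 'n) set) = (CARD('n) - 1) choose 2"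
proof -
  define m where "m = Min (UNIV :: 'n set)"
  have le: "m \<le> i" for i by (simp add: m_def)
  have iff: "i = m \<and> i < j \<and> j < k \<longleftrightarrow> i = m \<and> j \<noteq> m \<and> k \<noteq> m \<and> j < k" for i j k
    using le[of j] by auto
  let ?A = "{(i, j). i \<in> UNIV - {m} \<and> j \<in> UNIV - {m} \<and> i < j}"
  have "anchored_triple_labels = Pair m ` ?A"
    unfolding anchored_triple_labels_def m_def[symmetric] iff by (auto simp: image_iff)
  moreover have "card (Pair m ` ?A) = card ?A"
    by (intro card_image inj_onI) simp
  ultimately have "card (anchored_triple_labels :: ('n \<times> 'n \<times> 'n) set) = card ?A"
    by (simp only:)
  also have "\<dots> = (CARD('n) - 1) choose 2"
    by (subst card_less_pairs) (simp_all add: card_Diff_singleton)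
  finally show ?thesis .
qed

text \<open>Two consecutive triangular numbers add up to a square.\<close>

lemma choose_two_add_pred:
  assumes "0 < n"
  shows "(n choose 2) + ((n - 1) choose 2) = (n - 1)\<^sup>2"
proof -
  have "(Suc m choose 2) + (m choose 2) = m\<^sup>2" for m
    by (induction m) (simp_all add: numeral_2_eq_2 algebra_simps)
  then show ?thesis using assms by (cases n) auto
qed

section \<open>From a coboundary to a sign vector\<close>

text \<open>Take \<epsilon> to be -1 where \<open>p\<close> is 1. Then the product of two of its
  entries is -1 exactly when \<open>p i + p j = 1\<close>, that is, on edges whose correlations have
  opposite signs; diagonal and zero entries agree anyway.\<close>

lemma sign_conjugate_if_coboundary:
  fixes \<Sigma> \<Sigma>' :: "real ^ 'n ^ 'n" and p :: "'n \<Rightarrow> bit"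
  assumes diag: "\<And>i. \<Sigma> $ i $ i = 1" "\<And>i. \<Sigma>' $ i $ i = 1"
    and abs: "\<And>i j. i \<noteq> j \<Longrightarrow> \<bar>\<Sigma>' $ i $ j\<bar> = \<bar>\<Sigma> $ i $ j\<bar>"
    and p: "\<And>i j. i \<noteq> j \<Longrightarrow> \<Sigma> $ i $ j \<noteq> 0 \<Longrightarrow> of_bool (\<Sigma> $ i $ j * \<Sigma>' $ i $ j < 0) = p i + p j"
  shows "sign_conjugate \<Sigma> \<Sigma>'"
proof -
  define \<epsilon> :: "real ^ 'n" where "\<epsilon> = (\<chi> i. if p i = 0 then 1 else -1)"
  have "(diag \<epsilon> ** \<Sigma> ** diag \<epsilon>) $ i $ j = \<epsilon> $ i * \<Sigma> $ i $ j * \<epsilon> $ j" for i j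
    by (simp add: matrix_matrix_mult_def diag_def if_distrib[of "\<lambda>t. t * _"] if_distrib[of "\<lambda>t. _ * t"]
        cong: if_cong)
  moreover have "\<Sigma>' $ i $ j = \<epsilon> $ i * \<Sigma> $ i $ j * \<epsilon> $ j" for i j
  proof (cases "i = j \<or> \<Sigma> $ i $ j = 0")
    case True
    then show ?thesis using diag abs[of i j] by (cases "i = j") (auto simp: \<epsilon>_def)
  next
    case False
    then have e: "\<Sigma>' $ i $ j = (if \<Sigma> $ i $ j * \<Sigma>' $ i $ j < 0 then - \<Sigma> $ i $ j else \<Sigma> $ i $ j)"
      using abs[of i j] by (auto simp: abs_eq_iff mult_less_0_iff)
    show ?thesis
      using p[of i j] False by (subst e) (cases "p i"; cases "p j"; auto simp: \<epsilon>_def split: if_splits)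
  qed
  ultimately have "\<Sigma>' = diag \<epsilon> ** \<Sigma> ** diag \<epsilon>" by (simp add: vec_eq_iff)
  then show ?thesis
    unfolding sign_conjugate_def by (intro exI[of _ \<epsilon>]) (simp add: \<epsilon>_def)
qed

section \<open>Identifiability\<close>

context
  fixes M :: "'a measure" and X :: "'a \<Rightarrow> real ^ 'n" and \<Sigma> :: "real ^ 'n ^ 'n"
    and M' :: "'b measure" and X' :: "'b \<Rightarrow> real ^ 'n" and \<Sigma>' :: "real ^ 'n ^ 'n"
  assumes std: "standard_gaussian_vector M X \<Sigma>"
    and std': "standard_gaussian_vector M' X' \<Sigma>'"
begin

text \<open>The context does not assume equal moments, so the two vectors can exchange roles when
  both directions are needed.\<close>

lemma abs_correlation_less_imp_moment_less:
  assumes "\<bar>\<Sigma>' $ i $ j\<bar> < \<bar>\<Sigma> $ i $ j\<bar>"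
  shows "(\<integral>\<omega>. \<bar>X' \<omega> $ i * X' \<omega> $ j\<bar> \<partial>M') < (\<integral>\<omega>. \<bar>X \<omega> $ i * X \<omega> $ j\<bar> \<partial>M)"
  by (rule abs_pair_moment_strict_mono[OF
        std_gaussian_prob_space[OF std] std_gaussian_measurable[OF std] std_gaussian_measurable[OF std]
        std_gaussian_expectation_cos_2[OF std]
        std_gaussian_prob_space[OF std'] std_gaussian_measurable[OF std'] std_gaussian_measurable[OF std']
        std_gaussian_expectation_cos_2[OF std']
        integrable_abs[OF std_gaussian_integrable_mult[OF std]]
        integrable_abs[OF std_gaussian_integrable_mult[OF std']] assms])

lemma correlation_sign_imp_moment_less:
  assumes "\<bar>\<Sigma>' $ i $ j\<bar> = \<bar>\<Sigma> $ i $ j\<bar>" "\<bar>\<Sigma>' $ i $ k\<bar> = \<bar>\<Sigma> $ i $ k\<bar>" "\<bar>\<Sigma>' $ j $ k\<bar> = \<bar>\<Sigma> $ j $ k\<bar>"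
    and "0 < \<Sigma> $ i $ j * \<Sigma> $ i $ k * \<Sigma> $ j $ k" "\<Sigma>' $ i $ j * \<Sigma>' $ i $ k * \<Sigma>' $ j $ k < 0"
  shows "(\<integral>\<omega>. \<bar>X' \<omega> $ i * X' \<omega> $ j * X' \<omega> $ k\<bar> \<partial>M') < (\<integral>\<omega>. \<bar>X \<omega> $ i * X \<omega> $ j * X \<omega> $ k\<bar> \<partial>M)"
  by (rule abs_triple_moment_less_if_sign[OF
        std_gaussian_prob_space[OF std] std_gaussian_measurable[OF std] std_gaussian_measurable[OF std]
        std_gaussian_measurable[OF std] std_gaussian_expectation_cos_3[OF std]
        std_gaussian_prob_space[OF std'] std_gaussian_measurable[OF std'] std_gaussian_measurable[OF std']
        std_gaussian_measurable[OF std'] std_gaussian_expectation_cos_3[OF std']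
        integrable_abs[OF std_gaussian_integrable_mult3[OF std]]
        integrable_abs[OF std_gaussian_integrable_mult3[OF std']] assms])

end

text \<open>The values lie in \<open>bit\<close> so that products of signs become sums and the edge
  signs form a cochain.\<close>

definition sign_change :: "real ^ 'n ^ 'n \<Rightarrow> real ^ 'n ^ 'n \<Rightarrow> 'n \<Rightarrow> 'n \<Rightarrow> bit" where
  "sign_change \<Sigma> \<Sigma>' i j = of_bool (\<Sigma> $ i $ j * \<Sigma>' $ i $ j < 0)"

context
  fixes M :: "'a measure" and X :: "'a \<Rightarrow> real ^ 'n::{finite,linorder}"
    and \<Sigma> :: "real ^ 'n::{finite,linorder} ^ 'n::{finite,linorder}"
    and M' :: "'b measure" and X' :: "'b \<Rightarrow> real ^ 'n::{finite,linorder}"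
    and \<Sigma>' :: "real ^ 'n::{finite,linorder} ^ 'n::{finite,linorder}"
  assumes std: "standard_gaussian_vector M X \<Sigma>"
    and std': "standard_gaussian_vector M' X' \<Sigma>'"
    and pairs: "\<forall>p\<in>pair_labels. abs_pair_moment M' X' p = abs_pair_moment M X p"
begin

text \<open>A strict inequality in either direction would separate the pair moments. Labels are
  increasing pairs; symmetry of both matrices covers the rest.\<close>

lemma abs_correlation_eq:
  assumes "i \<noteq> j"
  shows "\<bar>\<Sigma>' $ i $ j\<bar> = \<bar>\<Sigma> $ i $ j\<bar>"
proof -
  have less: "\<bar>\<Sigma>' $ i $ j\<bar> = \<bar>\<Sigma> $ i $ j\<bar>" if "i < j" for i j
  proof -
    have "(\<integral>\<omega>. \<bar>X' \<omega> $ i * X' \<omega> $ j\<bar> \<partial>M') = (\<integral>\<omega>. \<bar>X \<omega> $ i * X \<omega> $ j\<bar> \<partial>M)"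
      using pairs that by (auto simp: pair_labels_def abs_pair_moment_def)
    then show ?thesis
      using abs_correlation_less_imp_moment_less[OF std std', of i j]
        abs_correlation_less_imp_moment_less[OF std' std, of i j]
      by (cases "\<bar>\<Sigma>' $ i $ j\<bar>" "\<bar>\<Sigma> $ i $ j\<bar>" rule: linorder_cases) simp_all
  qed
  show ?thesis
  proof (cases "i < j")
    case False
    then have "j < i" using assms by simp
    then show ?thesis
      using less[of j i] by (simp add: std_gaussian_sym[OF std, of i] std_gaussian_sym[OF std', of i])
  qed (rule less)
qed

lemma sign_change_sym: "sign_change \<Sigma> \<Sigma>' i j = sign_change \<Sigma> \<Sigma>' j i"
  unfolding sign_change_def
  using std_gaussian_sym[OF std, of i j] std_gaussian_sym[OF std', of i j] by simp

lemma even_negative_factors: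
  fixes p q r :: real
  assumes "0 < p * q * r"
  shows "of_bool (p < 0) + of_bool (q < 0) + of_bool (r < 0) = (0 :: bit)"
proof -
  have "(p < 0) \<noteq> (q < 0) \<longleftrightarrow> r < 0"
    using assms by (auto simp: zero_less_mult_iff mult_less_0_iff)
  then show ?thesis
    by (cases "p < 0"; cases "q < 0") simp_all
qed

text \<open>Correlation products of opposite sign would separate the triple moments, so the two
  products have the same sign and an even number of the edges change sign.\<close>

lemma sign_change_triangle:
  assumes moment: "abs_triple_moment M' X' (i, j, k) = abs_triple_moment M X (i, j, k)"
    and ne: "i \<noteq> j" "j \<noteq> k" "i \<noteq> k"
    and nz: "\<Sigma> $ i $ j \<noteq> 0" "\<Sigma> $ j $ k \<noteq> 0" "\<Sigma> $ i $ k \<noteq> 0"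
  shows "sign_change \<Sigma> \<Sigma>' i j + sign_change \<Sigma> \<Sigma>' j k + sign_change \<Sigma> \<Sigma>' i k = 0"
proof -
  note abs = abs_correlation_eq[OF ne(1)] abs_correlation_eq[OF ne(3)] abs_correlation_eq[OF ne(2)]
  have nz': "\<Sigma>' $ i $ j \<noteq> 0" "\<Sigma>' $ j $ k \<noteq> 0" "\<Sigma>' $ i $ k \<noteq> 0"
    using abs nz by auto
  let ?q = "\<Sigma> $ i $ j * \<Sigma> $ i $ k * \<Sigma> $ j $ k" and ?q' = "\<Sigma>' $ i $ j * \<Sigma>' $ i $ k * \<Sigma>' $ j $ k"
  have eq: "(\<integral>\<omega>. \<bar>X' \<omega> $ i * X' \<omega> $ j * X' \<omega> $ k\<bar> \<partial>M') = (\<integral>\<omega>. \<bar>X \<omega> $ i * X \<omega> $ j * X \<omega> $ k\<bar> \<partial>M)"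
    using moment by (simp add: abs_triple_moment_def)
  have "\<not> (0 < ?q \<and> ?q' < 0)"
    using correlation_sign_imp_moment_less[OF std std' abs] unfolding eq by blast
  moreover have "\<not> (0 < ?q' \<and> ?q < 0)"
    using correlation_sign_imp_moment_less[OF std' std abs[symmetric]] unfolding eq by blast
  moreover have "?q \<noteq> 0" "?q' \<noteq> 0"
    using nz nz' by simp_all
  moreover have "0 < s * t" if "\<not> (0 < s \<and> t < 0)" "\<not> (0 < t \<and> s < 0)" "s \<noteq> 0" "t \<noteq> 0" for s t :: real
    using that by (auto simp: zero_less_mult_iff)
  ultimately have "0 < ?q * ?q'"
    by blast
  \<comment> \<open>Regrouping by edges exhibits the factors whose signs \<open>sign_change\<close>
    records.\<close>
  also have "\<dots> = (\<Sigma> $ i $ j * \<Sigma>' $ i $ j) * (\<Sigma> $ j $ k * \<Sigma>' $ j $ k) * (\<Sigma> $ i $ k * \<Sigma>' $ i $ k)"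
    by (simp only: mult_ac)
  finally show ?thesis
    unfolding sign_change_def by (rule even_negative_factors)
qed

lemma sign_conjugate_if_sign_change_coboundary:
  assumes "\<And>i j. i \<noteq> j \<Longrightarrow> \<Sigma> $ i $ j \<noteq> 0 \<Longrightarrow> sign_change \<Sigma> \<Sigma>' i j = p i + p j"
  shows "sign_conjugate \<Sigma> \<Sigma>'"
  by (rule sign_conjugate_if_coboundary[OF std_gaussian_diag[OF std] std_gaussian_diag[OF std']
        abs_correlation_eq assms[unfolded sign_change_def]])

lemma edge_iff: "{i, j} \<in> correlation_edges \<Sigma> \<longleftrightarrow> i \<noteq> j \<and> \<Sigma> $ i $ j \<noteq> 0"
  using std_gaussian_sym[OF std, of i j] by (auto simp: correlation_edges_def doubleton_eq_iff)

lemma sign_conjugate_if_triangles_generate: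
  assumes triples: "\<forall>t\<in>triple_labels. abs_triple_moment M' X' t = abs_triple_moment M X t"
    and gen: "triangle_space (correlation_edges \<Sigma>) = cycle_space (correlation_edges \<Sigma>)"
  shows "sign_conjugate \<Sigma> \<Sigma>'"
proof -
  let ?n = "sign_change \<Sigma> \<Sigma>'"
  have moment: "abs_triple_moment M' X' (i, j, k) = abs_triple_moment M X (i, j, k)"
    if ne: "i \<noteq> j" "j \<noteq> k" "i \<noteq> k" for i j k
  proof -
    let ?P = "\<lambda>(i, j, k). abs_triple_moment M' X' (i, j, k) = abs_triple_moment M X (i, j, k)"
    have sorted: "?P (i, j, k)" if "i < j" "j < k" for i j k
      using triples that by (auto simp: triple_labels_def)
    \<comment> \<open>Adjacent transpositions generate all orderings, so equality on increasing
      labels extends to all triples of distinct indices.\<close>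
    have swap: "?P (j, i, k) \<longleftrightarrow> ?P (i, j, k)" "?P (i, k, j) \<longleftrightarrow> ?P (i, j, k)" for i j k
      by (simp_all add: abs_triple_moment_def mult_ac)
    consider "i < j" "j < k" | "i < k" "k < j" | "j < i" "i < k" | "j < k" "k < i"
      | "k < i" "i < j" | "k < j" "j < i"
      using ne by (metis linorder_neqE)
    then have "?P (i, j, k)"
      by cases (use sorted swap in blast)+
    then show ?thesis by simp
  qed
  \<comment> \<open>This transfers \<open>sign_change\<close> from ordered pairs to edges, which is
    consistent by its symmetry.\<close>
  define s where "s e = (of_bool (\<exists>i j. e = {i, j} \<and> ?n i j = 1) :: bit)" for e
  have s: "s {i, j} = ?n i j" for i j
  proof -
    have "(\<exists>i' j'. {i, j} = {i', j'} \<and> ?n i' j' = 1) \<longleftrightarrow> ?n i j = 1"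
      using sign_change_sym by (auto simp: doubleton_eq_iff)
    then show ?thesis by (cases "?n i j") (simp_all add: s_def)
  qed
  obtain p where "\<And>i j. i \<noteq> j \<Longrightarrow> {i, j} \<in> correlation_edges \<Sigma> \<Longrightarrow> s {i, j} = p i + p j"
  proof (rule coboundary_if_triangles_generate_cycles[OF gen, of s])
    show "s {i, j} + s {j, k} + s {i, k} = 0" if "i \<noteq> j" "j \<noteq> k" "i \<noteq> k"
      "{i, j} \<in> correlation_edges \<Sigma>" "{j, k} \<in> correlation_edges \<Sigma>" "{i, k} \<in> correlation_edges \<Sigma>" for i j k
      unfolding s
      by (rule sign_change_triangle[OF moment]) (use that in \<open>simp_all add: edge_iff\<close>)
  qed blast
  then show ?thesis
    by (intro sign_conjugate_if_sign_change_coboundary[of p]) (simp only: edge_iff s simp_thms)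
qed

text \<open>Every edge avoiding the least vertex \<open>m\<close> lies in a triangle through
  \<open>m\<close>. The sign changes along the star at \<open>m\<close> therefore already give the
  potential \<open>p\<close>.\<close>

lemma sign_conjugate_if_complete:
  assumes triples: "\<forall>t\<in>anchored_triple_labels. abs_triple_moment M' X' t = abs_triple_moment M X t"
    and complete: "is_complete (correlation_edges \<Sigma>)"
  shows "sign_conjugate \<Sigma> \<Sigma>'"
proof -
  let ?n = "sign_change \<Sigma> \<Sigma>'"
  define m where "m = Min (UNIV :: 'n set)"
  have m: "m < i" if "i \<noteq> m" for i
    using that by (simp add: m_def order_less_le)
  have nz: "\<Sigma> $ i $ j \<noteq> 0" if "i \<noteq> j" for i j
    using complete that edge_iff by (auto simp: is_complete_def)
  \<comment> \<open>The value 0 at \<open>m\<close> makes the coboundary equation immediate on edges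
    at \<open>m\<close>; the anchored triangles give the remaining edges.\<close>
  define p where "p i = (if i = m then 0 else ?n m i)" for i
  have less: "?n i j = p i + p j" if "i < j" for i j
  proof (cases "i = m")
    case True
    then show ?thesis using that by (auto simp: p_def)
  next
    case False
    with that m have mi: "m < i" "m \<noteq> j" by (blast, fastforce)
    have "?n m i + ?n i j + ?n m j = 0"
    proof (rule sign_change_triangle)
      show "abs_triple_moment M' X' (m, i, j) = abs_triple_moment M X (m, i, j)"
        using triples mi that by (auto simp: anchored_triple_labels_def m_def)
    qed (use mi that nz in auto)
    then show ?thesis
      using mi by (cases "?n m i"; cases "?n i j"; cases "?n m j") (simp_all add: p_def)
  qed
  have "?n i j = p i + p j" if "i \<noteq> j" for i j
    using that less[of i j] less[of j i] sign_change_sym[of i j]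
    by (metis add.commute linorder_neqE)
  then show ?thesis by (intro sign_conjugate_if_sign_change_coboundary[of p])
qed

end

section \<open>Moments of the folded vector and the final assembly\<close>

lemma pair_moment_folded: "pair_moment M (folded X) = abs_pair_moment M X"
  by (simp add: fun_eq_iff pair_moment_def abs_pair_moment_def folded_def abs_mult)

lemma triple_moment_folded: "triple_moment M (folded X) = abs_triple_moment M X"
  by (simp add: fun_eq_iff triple_moment_def abs_triple_moment_def folded_def abs_mult)

theorem theorem10p1:
  fixes M :: "'a measure"
    and X :: "'a \<Rightarrow> real ^ 'n::{finite,linorder}"
    and \<Sigma> :: "real ^ 'n::{finite,linorder} ^ 'n::{finite,linorder}"
  assumes gauss: "standard_gaussian_vector M X \<Sigma>"
    and less_one: "\<And>i j. i \<noteq> j \<Longrightarrow> \<bar>\<Sigma> $ i $ j\<bar> < 1"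
  shows
    "(triangle_space (correlation_edges \<Sigma>) = cycle_space (correlation_edges \<Sigma>) \<longrightarrow>
       (\<forall>(M' :: 'b measure) X' \<Sigma>'.
          standard_gaussian_vector M' X' \<Sigma>' \<and>
          (\<forall>p\<in>pair_labels. abs_pair_moment M' X' p = abs_pair_moment M X p) \<and>
          (\<forall>t\<in>triple_labels. abs_triple_moment M' X' t = abs_triple_moment M X t)
          \<longrightarrow> sign_conjugate \<Sigma> \<Sigma>'))
     \<and> (is_complete (correlation_edges \<Sigma>) \<longrightarrow>
       (\<forall>(M' :: 'b measure) X' \<Sigma>'.
          standard_gaussian_vector M' X' \<Sigma>' \<and>
          (\<forall>p\<in>pair_labels. abs_pair_moment M' X' p = abs_pair_moment M X p) \<and>
          (\<forall>t\<in>anchored_triple_labels. abs_triple_moment M' X' t = abs_triple_moment M X t)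
          \<longrightarrow> sign_conjugate \<Sigma> \<Sigma>'))
     \<and> card (pair_labels :: ('n \<times> 'n) set) + card (anchored_triple_labels :: ('n \<times> 'n \<times> 'n) set)
         = (CARD('n) choose 2) + ((CARD('n) - 1) choose 2)
     \<and> (CARD('n) choose 2) + ((CARD('n) - 1) choose 2) = (CARD('n) - 1)\<^sup>2
     \<and> (triangle_space (correlation_edges \<Sigma>) = cycle_space (correlation_edges \<Sigma>) \<longrightarrow>
       (\<forall>(M' :: 'b measure) X' \<Sigma>'.
          standard_gaussian_vector M' X' \<Sigma>' \<and>
          (\<forall>p\<in>pair_labels. pair_moment M' (folded X') p = pair_moment M (folded X) p) \<and>
          (\<forall>t\<in>triple_labels. triple_moment M' (folded X') t = triple_moment M (folded X) t)
          \<longrightarrow> sign_conjugate \<Sigma> \<Sigma>'))"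
proof -
  show ?thesis
    \<comment> \<open>After this rewriting the folded-normal claim coincides with the first
      one.\<close>
    unfolding pair_moment_folded triple_moment_folded
  proof (intro conjI allI impI, goal_cases)
    case 3
    show ?case by (simp add: card_pair_labels card_anchored_triple_labels)
  next
    case 4
    show ?case by (rule choose_two_add_pred) simp
  qed (use sign_conjugate_if_triangles_generate[OF gauss] sign_conjugate_if_complete[OF gauss] in blast)+
qed

end
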